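(* Let $E=\mathrm{ind}_m E_m$ be an LF-space with stepwise Schauder basis $(e_j)_{j\in\mathbb{N}}$ and associated backward shift $B$. (a) The following are equivalent. (i) $B$ is transitive on $E$. (ii) There are $m\in\mathbb{N}$ and a strictly increasing sequence $(j_k)_{k\in\mathbb{N}}$ of natural numbers such that $\lim_{k\to\infty}e_{j_k}=0$ in $E_m$. (b) The following are equivalent. (i) $B$ is topologically mixing on $E$. (ii) For every infinite subset $I\subseteq\mathbb{N}$ there are $m\in\mathbb{N}$ and a strictly increasing sequence $(j_k)_{k\in\mathbb{N}}$ of elements of $I$ such that $\lim_{k\to\infty}e_{j_k}=0$ in $E_m$.
   Context: $\mathbb{N}=\{1,2,\dots\}$, and $\mathbb{K}\in\{\mathbb{R},\mathbb{C}\}$ is the scalar field. LF-space: an inductive spectrum of Fréchet spaces $(E_m)_{m\in\mathbb{N}}$ is an increasing sequence of Fréchet spaces such that each inclusion $E_m\subset E_{m+1}$ is continuous. Its inductive limit (LF-space) $E=\mathrm{ind}_m E_m$ is the union $\bigcup_m E_m$ with the finest locally convex topology making every inclusion $E_m\subset E$ continuous; this topology is assumed to be Hausdorff. Stepwise Schauder basis: a sequence $(e_j)_{j\in\mathbb{N}}$ in $E_1$ which is a Schauder basis of $E_m$ for every $m\in\mathbb{N}$. Associated backward shift: if the linear map on $\mathrm{span}\{e_j: j\in\mathbb{N}\}$ given by $Be_1:=0$, $Be_j:=e_{j-1}$ for $j\ge 2$, extends to a continuous linear map $B:E\to E$, then $B$ is called the backward shift associated with $(e_j)_j$. Saying that $E$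 has associated backward shift $B$ means that this continuous extension exists. For a continuous linear operator $T$ on $E$ and non-empty open $U,V\subseteq E$ put $N_T(U,V)=\{n\in\mathbb{N}: T^n(U)\cap V\neq\emptyset\}$. $T$ is (topologically) transitive if $N_T(U,V)\neq\emptyset$ for all non-empty open $U,V\subseteq E$; $T$ is (topologically) mixing if $N_T(U,V)$ is cofinite in $\mathbb{N}$ for all non-empty open $U,V\subseteq E$. *)

theory Defs
  imports "HOL-Analysis.Analysis"
begin

text \<open>
  Conventions. A topological vector space over the scalar field \<open>'k\<close> is given by a scalar
  multiplication \<open>s\<close> satisfying \<^locale>\<open>vector_space\<close> on an ambient type, together with an abstract
  topology \<open>X\<close> whose \<^const>\<open>topspace\<close> is the (carrier of the) space; the ambient type itself
  carries no topology. Sequences indexed by the positive integers (the steps \<open>E\<^sub>m\<close>, the basis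
  vectors \<open>e\<^sub>j\<close>, strictly increasing index sequences) are indexed from \<open>0\<close> here, so that \<open>T 0\<close> is the
  topology of the first step and \<open>e 0\<close> is the first basis vector. Return sets are subsets of the
  positive integers, since there the number is an exponent and not an index.
\<close>

text \<open>The scalar field is the field of real or of complex numbers, with its usual absolute value.\<close>

class real_or_complex_field = real_normed_field +
  assumes real_or_complex:
    "(\<forall>z::'a. \<exists>a. z = a *\<^sub>R 1) \<or>
     (\<exists>i::'a. i * i = - 1 \<and>
        (\<forall>z. \<exists>a b. z = a *\<^sub>R 1 + b *\<^sub>R i \<and> norm z = sqrt (a\<^sup>2 + b\<^sup>2)))"

instance real :: real_or_complex_field
  by standard auto

instance complex :: real_or_complex_field
proof
  have "\<exists>a b. z = a *\<^sub>R 1 + b *\<^sub>R \<i> \<and> cmod z = sqrt (a\<^sup>2 + b\<^sup>2)" for z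
    by (intro exI[of _ "Re z"] exI[of _ "Im z"]) (simp add: complex_eq_iff cmod_def)
  then show "(\<forall>z::complex. \<exists>a. z = a *\<^sub>R 1) \<or>
     (\<exists>i::complex. i * i = - 1 \<and>
        (\<forall>z. \<exists>a b. z = a *\<^sub>R 1 + b *\<^sub>R i \<and> norm z = sqrt (a\<^sup>2 + b\<^sup>2)))"
    by (intro disjI2 exI[of _ \<i>]) simp
qed

definition topological_vector_space ::
    "('k::real_or_complex_field \<Rightarrow> 'a::ab_group_add \<Rightarrow> 'a) \<Rightarrow> 'a topology \<Rightarrow> bool" where
  "topological_vector_space s X \<longleftrightarrow>
     vector_space s \<and> module.subspace s (topspace X) \<and>
     continuous_map (prod_topology X X) X (\<lambda>(x, y). x + y) \<and>
     continuous_map (prod_topology euclidean X) X (\<lambda>(c, x). s c x)"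

definition convex_wrt ::
    "('k::real_or_complex_field \<Rightarrow> 'a::ab_group_add \<Rightarrow> 'a) \<Rightarrow> 'a set \<Rightarrow> bool" where
  "convex_wrt s C \<longleftrightarrow>
     (\<forall>x\<in>C. \<forall>y\<in>C. \<forall>t::real. 0 \<le> t \<and> t \<le> 1 \<longrightarrow> s (of_real (1 - t)) x + s (of_real t) y \<in> C)"

text \<open>Locally convex spaces are not required to be Hausdorff.\<close>

definition locally_convex_space ::
    "('k::real_or_complex_field \<Rightarrow> 'a::ab_group_add \<Rightarrow> 'a) \<Rightarrow> 'a topology \<Rightarrow> bool" where
  "locally_convex_space s X \<longleftrightarrow>
     topological_vector_space s X \<and>
     (\<forall>U. openin X U \<and> 0 \<in> U \<longrightarrow> (\<exists>V. openin X V \<and> convex_wrt s V \<and> 0 \<in> V \<and> V \<subseteq> U))"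

text \<open>A Frechet space: locally convex, with the topology of a complete translation-invariant metric.\<close>

definition frechet_space ::
    "('k::real_or_complex_field \<Rightarrow> 'a::ab_group_add \<Rightarrow> 'a) \<Rightarrow> 'a topology \<Rightarrow> bool" where
  "frechet_space s X \<longleftrightarrow>
     locally_convex_space s X \<and>
     (\<exists>d. Metric_space (topspace X) d \<and>
          Metric_space.mcomplete (topspace X) d \<and>
          Metric_space.mtopology (topspace X) d = X \<and>
          (\<forall>x\<in>topspace X. \<forall>y\<in>topspace X. \<forall>z\<in>topspace X. d (x + z) (y + z) = d x y))"

definition inductive_spectrum ::
    "('k::real_or_complex_field \<Rightarrow> 'a::ab_group_add \<Rightarrow> 'a) \<Rightarrow> (nat \<Rightarrow> 'a topology) \<Rightarrow> bool" where
  "inductive_spectrum s T \<longleftrightarrow>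
     (\<forall>m. frechet_space s (T m)) \<and>
     (\<forall>m. topspace (T m) \<subseteq> topspace (T (Suc m)) \<and> continuous_map (T m) (T (Suc m)) id)"

text \<open>
  Locally convex topologies on the union of the steps for which all inclusions are continuous;
  the inductive limit topology is the finest of them.
\<close>

definition compatible_topology ::
    "('k::real_or_complex_field \<Rightarrow> 'a::ab_group_add \<Rightarrow> 'a) \<Rightarrow> (nat \<Rightarrow> 'a topology)
      \<Rightarrow> 'a topology \<Rightarrow> bool" where
  "compatible_topology s T X \<longleftrightarrow>
     topspace X = (\<Union>m. topspace (T m)) \<and> locally_convex_space s X \<and>
     (\<forall>m. continuous_map (T m) X id)"

definition inductive_limit ::
    "('k::real_or_complex_field \<Rightarrow> 'a::ab_group_add \<Rightarrow> 'a) \<Rightarrow> (nat \<Rightarrow> 'a topology)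
      \<Rightarrow> 'a topology \<Rightarrow> bool" where
  "inductive_limit s T X \<longleftrightarrow>
     compatible_topology s T X \<and>
     (\<forall>Y. compatible_topology s T Y \<longrightarrow> (\<forall>U. openin Y U \<longrightarrow> openin X U))"

definition LF_space ::
    "('k::real_or_complex_field \<Rightarrow> 'a::ab_group_add \<Rightarrow> 'a) \<Rightarrow> (nat \<Rightarrow> 'a topology)
      \<Rightarrow> 'a topology \<Rightarrow> bool" where
  "LF_space s T X \<longleftrightarrow>
     inductive_spectrum s T \<and> inductive_limit s T X \<and> Hausdorff_space X"

definition schauder_basis ::
    "('k::real_or_complex_field \<Rightarrow> 'a::ab_group_add \<Rightarrow> 'a) \<Rightarrow> 'a topology
      \<Rightarrow> (nat \<Rightarrow> 'a) \<Rightarrow> bool" where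
  "schauder_basis s X e \<longleftrightarrow>
     range e \<subseteq> topspace X \<and>
     (\<forall>x\<in>topspace X. \<exists>!a. limitin X (\<lambda>n. \<Sum>j<n. s (a j) (e j)) x sequentially)"

definition stepwise_schauder_basis ::
    "('k::real_or_complex_field \<Rightarrow> 'a::ab_group_add \<Rightarrow> 'a) \<Rightarrow> (nat \<Rightarrow> 'a topology)
      \<Rightarrow> (nat \<Rightarrow> 'a) \<Rightarrow> bool" where
  "stepwise_schauder_basis s T e \<longleftrightarrow>
     range e \<subseteq> topspace (T 0) \<and> (\<forall>m. schauder_basis s (T m) e)"

text \<open>The values of operators outside of the carrier are irrelevant.\<close>

definition continuous_linear_operator ::
    "('k::real_or_complex_field \<Rightarrow> 'a::ab_group_add \<Rightarrow> 'a) \<Rightarrow> 'a topology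
      \<Rightarrow> ('a \<Rightarrow> 'a) \<Rightarrow> bool" where
  "continuous_linear_operator s X B \<longleftrightarrow>
     continuous_map X X B \<and>
     (\<forall>x\<in>topspace X. \<forall>y\<in>topspace X. B (x + y) = B x + B y) \<and>
     (\<forall>c. \<forall>x\<in>topspace X. B (s c x) = s c (B x))"

text \<open>
  A linear \<open>B\<close> extends the backward shift on the span of the \<open>e\<^sub>j\<close> iff it has the prescribed values
  on the \<open>e\<^sub>j\<close>.
\<close>

definition associated_backward_shift ::
    "('k::real_or_complex_field \<Rightarrow> 'a::ab_group_add \<Rightarrow> 'a) \<Rightarrow> 'a topology
      \<Rightarrow> (nat \<Rightarrow> 'a) \<Rightarrow> ('a \<Rightarrow> 'a) \<Rightarrow> bool" where
  "associated_backward_shift s X e B \<longleftrightarrow>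
     continuous_linear_operator s X B \<and> B (e 0) = 0 \<and> (\<forall>j. B (e (Suc j)) = e j)"

definition return_set :: "('a \<Rightarrow> 'a) \<Rightarrow> 'a set \<Rightarrow> 'a set \<Rightarrow> nat set" where
  "return_set B U V = {n. 1 \<le> n \<and> (B ^^ n) ` U \<inter> V \<noteq> {}}"

definition topologically_transitive :: "'a topology \<Rightarrow> ('a \<Rightarrow> 'a) \<Rightarrow> bool" where
  "topologically_transitive X B \<longleftrightarrow>
     (\<forall>U V. openin X U \<and> U \<noteq> {} \<and> openin X V \<and> V \<noteq> {} \<longrightarrow> return_set B U V \<noteq> {})"

definition topologically_mixing :: "'a topology \<Rightarrow> ('a \<Rightarrow> 'a) \<Rightarrow> bool" where
  "topologically_mixing X B \<longleftrightarrow>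
     (\<forall>U V. openin X U \<and> U \<noteq> {} \<and> openin X V \<and> V \<noteq> {} \<longrightarrow> finite ({1..} - return_set B U V))"

end

theory Submission
  imports Defs
begin

text \<open>
  Write \<open>x\<^sub>j\<close> for the coordinates of \<open>x\<close> with respect to \<open>e\<close>. They do not depend on the step in which
  \<open>x\<close> is expanded, since an expansion that converges in one step converges in all later ones. Fix a
  set \<open>J\<close> of indices such that no subsequence of \<open>e\<close> with indices in \<open>J\<close> tends to \<open>0\<close> in any step.

  In a single step the partial sum operators of a Schauder basis are equicontinuous (lemma
  \<open>sup_ball_neighbourhood\<close>, a direct Baire category argument with successive approximation). Hence
  the vectors \<open>x\<^sub>j e\<^sub>j\<close> are uniformly small when \<open>x\<close> is close to \<open>0\<close>; as the \<open>e\<^sub>j\<close> with \<open>j \<in> J\<close> stay away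
  from \<open>0\<close>, the scalars \<open>x\<^sub>j\<close> with \<open>j \<in> J\<close> are uniformly small, too. So \<open>q\<^sub>J x = sup\<^bsub>j \<in> J\<^esub> |x\<^sub>j|\<close> is a seminorm
  on the inductive limit that is continuous on every step, and therefore it is continuous on the
  inductive limit (lemma \<open>openin_inductive_limit_seminorm_ball\<close>). The case of a singleton \<open>J\<close>, for
  which the condition on \<open>J\<close> is void, yields continuity of the coordinate functionals.

  The operator \<open>B\<close> shifts coordinates, so the coordinate of \<open>B\<^sup>n x\<close> at \<open>0\<close> is \<open>x\<^sub>n\<close>. Points \<open>x\<close> with
  \<open>q\<^sub>J x < 1\<close> thus do not reach the set of all \<open>y\<close> with \<open>|y\<^sub>0 - 2| < 1\<close> at a time \<open>n \<in> J\<close> (lemma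
  \<open>return_set_avoids\<close>). With \<open>J\<close> the set of all indices this contradicts transitivity, and with an
  infinite \<open>J\<close> it contradicts mixing.

  Conversely, let \<open>e\<^bsub>j k\<^esub> \<longlonglongrightarrow> 0\<close> in some step, and hence in the inductive limit. Applying powers of \<open>B\<close>
  gives \<open>e\<^bsub>j k - l\<^esub> \<longlonglongrightarrow> 0\<close> in the inductive limit for each \<open>l\<close>. Given non-empty open sets \<open>U\<close> and \<open>V\<close>, take
  finite linear combinations \<open>u \<in> U\<close> and \<open>v \<in> V\<close> of \<open>e\<^sub>0, \<dots>, e\<^bsub>M - 1\<^esub>\<close> and set \<open>n = j k - M\<close>. Adding to \<open>u\<close>
  the forward shift of \<open>v\<close> by \<open>n\<close> perturbs \<open>u\<close> by a null sequence, and \<open>B\<^sup>n\<close> maps the sum to \<open>v\<close> if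
  \<open>n \<ge> M\<close>. So \<open>j k - M\<close> is eventually in the return set (lemma \<open>eventually_in_return_set\<close>), where \<open>M\<close>
  depends on \<open>U\<close> and \<open>V\<close> only. This gives transitivity, and mixing by choosing the indices \<open>j k\<close>
  in the translate by \<open>M\<close> of an alleged infinite set of times that are not return times.
\<close>

section \<open>The scalar field\<close>

lemma real_or_complex_Cauchy_convergent:
  fixes z :: "nat \<Rightarrow> 'k::real_or_complex_field"
  assumes "Cauchy z"
  shows "convergent z"
proof -
  have *: "convergent a" if "\<And>m n. \<bar>a m - a n\<bar> \<le> norm (z m - z n)" for a :: "nat \<Rightarrow> real"
  proof -
    have "Cauchy a"
      unfolding Cauchy_iff real_norm_def
      using assms that by (meson CauchyD le_less_trans)
    then show ?thesis
      by (simp add: Cauchy_convergent)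
  qed
  consider "\<forall>z::'k. \<exists>a. z = a *\<^sub>R 1"
    | i :: 'k where "i * i = - 1"
        "\<forall>z. \<exists>a b. z = a *\<^sub>R 1 + b *\<^sub>R i \<and> norm z = sqrt (a\<^sup>2 + b\<^sup>2)"
    using real_or_complex by blast
  then show ?thesis
  proof cases
    case 1
    then have "\<forall>n. \<exists>a. z n = a *\<^sub>R 1"
      by blast
    then obtain a where a: "\<And>n. z n = a n *\<^sub>R 1"
      using choice by meson
    have "norm (z m - z n) = \<bar>a m - a n\<bar>" for m n
      unfolding a scaleR_diff_left [symmetric] by simp
    then have "convergent a"
      by (intro *) simp
    then obtain l where "a \<longlonglongrightarrow> l"
      by (auto simp: convergent_def)
    then have "z \<longlonglongrightarrow> l *\<^sub>R 1"
      unfolding a by (intro tendsto_intros)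
    then show ?thesis
      by (auto simp: convergent_def)
  next
    case (2 i)
    \<comment> \<open>As \<open>i\<^sup>2 = - 1\<close>, a real relation between \<open>1\<close> and \<open>i\<close> would make a square negative.\<close>
    have unique: "a = a' \<and> b = b'" if "a *\<^sub>R 1 + b *\<^sub>R i = a' *\<^sub>R 1 + b' *\<^sub>R i" for a b a' b'
    proof -
      have "(a - a') *\<^sub>R 1 = (b' - b) *\<^sub>R i"
        using that by (simp add: algebra_simps)
      then have "((a - a') *\<^sub>R 1) * ((a - a') *\<^sub>R 1) = ((b' - b) *\<^sub>R i) * ((b' - b) *\<^sub>R i)"
        by simp
      then have "((a - a')\<^sup>2) *\<^sub>R (1::'k) = (- ((b' - b)\<^sup>2)) *\<^sub>R 1"
        using 2(1) by (simp add: power2_eq_square)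
      then have "(a - a')\<^sup>2 = - ((b' - b)\<^sup>2)"
        by (simp only: scaleR_cancel_right) simp
      then have "(a - a')\<^sup>2 + (b' - b)\<^sup>2 = 0"
        by simp
      then show ?thesis
        by (simp add: sum_power2_eq_zero_iff)
    qed
    from 2(2) have "\<forall>n. \<exists>a b. z n = a *\<^sub>R 1 + b *\<^sub>R i"
      by blast
    then obtain a b where ab: "\<And>n. z n = a n *\<^sub>R 1 + b n *\<^sub>R i"
      by (auto simp: choice_iff)
    have norm: "norm (z m - z n) = sqrt ((a m - a n)\<^sup>2 + (b m - b n)\<^sup>2)" for m n
    proof -
      obtain a' b' where ab': "z m - z n = a' *\<^sub>R 1 + b' *\<^sub>R i"
          "norm (z m - z n) = sqrt (a'\<^sup>2 + b'\<^sup>2)"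
        using 2(2) by blast
      have "z m - z n = (a m - a n) *\<^sub>R 1 + (b m - b n) *\<^sub>R i"
        unfolding ab by (simp add: algebra_simps)
      with ab' unique show ?thesis
        by metis
    qed
    have "convergent a" "convergent b"
      by (intro *; simp add: norm real_sqrt_sum_squares_ge1 real_le_rsqrt)+
    then obtain k l where "a \<longlonglongrightarrow> k" "b \<longlonglongrightarrow> l"
      by (auto simp: convergent_def)
    then have "z \<longlonglongrightarrow> k *\<^sub>R 1 + l *\<^sub>R i"
      unfolding ab by (intro tendsto_intros)
    then show ?thesis
      by (auto simp: convergent_def)
  qed
qed

section \<open>Limits in topological vector spaces\<close>

text \<open>
  A topological vector space in the sense of \<^const>\<open>topological_vector_space\<close>; its elements are the
  points of \<open>topspace X\<close>.
\<close>

locale top_vector_space = vector_space s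
  for s :: "'k::real_or_complex_field \<Rightarrow> 'a::ab_group_add \<Rightarrow> 'a" +
  fixes X :: "'a topology"
  assumes tvs: "topological_vector_space s X"
begin

lemma subspace_topspace: "subspace (topspace X)"
  using tvs by (simp add: topological_vector_space_def)

lemma in_topspace:
  shows zero_in: "0 \<in> topspace X"
    and add_in: "x \<in> topspace X \<Longrightarrow> y \<in> topspace X \<Longrightarrow> x + y \<in> topspace X"
    and diff_in: "x \<in> topspace X \<Longrightarrow> y \<in> topspace X \<Longrightarrow> x - y \<in> topspace X"
    and scale_in: "x \<in> topspace X \<Longrightarrow> s c x \<in> topspace X"
    and minus_in: "x \<in> topspace X \<Longrightarrow> - x \<in> topspace X"
    and sum_in: "(\<And>i. i \<in> I \<Longrightarrow> f i \<in> topspace X) \<Longrightarrow> sum f I \<in> topspace X"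
  using subspace_topspace
  by (auto intro: subspace_0 subspace_add subspace_diff subspace_scale subspace_neg subspace_sum)

lemma limitin_add:
  assumes "limitin X f x F" "limitin X g y F"
  shows "limitin X (\<lambda>n. f n + g n) (x + y) F"
proof -
  have "limitin (prod_topology X X) (\<lambda>n. (f n, g n)) (x, y) F"
    using assms by (simp add: limitin_pairwise o_def)
  moreover have "continuous_map (prod_topology X X) X (\<lambda>(x, y). x + y)"
    using tvs by (simp add: topological_vector_space_def)
  ultimately show ?thesis
    using continuous_map_limit by (fastforce simp: o_def)
qed

lemma limitin_scale:
  assumes "(c \<longlongrightarrow> t) F" "limitin X f x F"
  shows "limitin X (\<lambda>n. s (c n) (f n)) (s t x) F"
proof -
  have "limitin (prod_topology euclidean X) (\<lambda>n. (c n, f n)) (t, x) F"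
    using assms by (simp add: limitin_pairwise o_def)
  moreover have "continuous_map (prod_topology euclidean X) X (\<lambda>(c, x). s c x)"
    using tvs by (simp add: topological_vector_space_def)
  ultimately show ?thesis
    using continuous_map_limit by (fastforce simp: o_def)
qed

lemma limitin_diff:
  assumes "limitin X f x F" "limitin X g y F"
  shows "limitin X (\<lambda>n. f n - g n) (x - y) F"
  using limitin_add [OF assms(1) limitin_scale [OF tendsto_const assms(2), of "-1"]]
  by simp

lemma limitin_sum:
  assumes "\<And>i. i \<in> I \<Longrightarrow> limitin X (f i) (x i) F"
  shows "limitin X (\<lambda>n. \<Sum>i\<in>I. f i n) (\<Sum>i\<in>I. x i) F"
  using assms
  by (induction I rule: infinite_finite_induct) (auto intro: limitin_add simp: zero_in)

end

section \<open>Schauder bases of completely metrizable topological vector spaces\<close>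

text \<open>
  An F-space: a topological vector space \<open>Y\<close> whose topology is given by a complete translation-invariant
  metric \<open>d\<close>. Local convexity plays no role in this section.
\<close>

locale F_space = top_vector_space s Y + Metric_space "topspace Y" d
  for s :: "'k::real_or_complex_field \<Rightarrow> 'a::ab_group_add \<Rightarrow> 'a"
    and Y :: "'a topology" and d :: "'a \<Rightarrow> 'a \<Rightarrow> real" +
  assumes complete: "mcomplete"
    and mtopology: "mtopology = Y"
    and translation_invariant:
      "\<lbrakk>x \<in> topspace Y; y \<in> topspace Y; z \<in> topspace Y\<rbrakk> \<Longrightarrow> d (x + z) (y + z) = d x y"
begin

text \<open>
  The F-norm of \<open>d\<close>. It is subadditive and even on \<open>topspace Y\<close>, but not homogeneous; continuity of the
  scalar multiplication has to replace homogeneity.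
\<close>

definition N :: "'a \<Rightarrow> real" where
  "N x = d x 0"

lemma d_eq_N:
  assumes "x \<in> topspace Y" "y \<in> topspace Y"
  shows "d x y = N (x - y)"
  using translation_invariant [of "x - y" 0 y] assms by (simp add: N_def in_topspace)

lemma N_ge_0 [simp]: "0 \<le> N x"
  by (simp add: N_def)

lemma N_zero [simp]: "N 0 = 0"
  by (simp add: N_def zero_in)

lemma N_eq_0_iff: "x \<in> topspace Y \<Longrightarrow> N x = 0 \<longleftrightarrow> x = 0"
  by (simp add: N_def zero_in)

lemma N_diff_commute:
  assumes "x \<in> topspace Y" "y \<in> topspace Y"
  shows "N (x - y) = N (y - x)"
  using assms by (simp add: commute flip: d_eq_N)

lemma N_minus: "x \<in> topspace Y \<Longrightarrow> N (- x) = N x"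
  using N_diff_commute [of 0 x] by (simp add: zero_in)

lemma N_triangle:
  assumes "x \<in> topspace Y" "y \<in> topspace Y"
  shows "N (x + y) \<le> N x + N y"
  using triangle [of x 0 "- y"] assms by (simp add: d_eq_N in_topspace N_minus)

lemma N_triangle_diff:
  assumes "x \<in> topspace Y" "y \<in> topspace Y"
  shows "N (x - y) \<le> N x + N y"
  using N_triangle [of x "- y"] assms by (simp add: in_topspace N_minus)

lemma limitin_iff_N:
  "limitin Y f x F \<longleftrightarrow>
     x \<in> topspace Y \<and> (\<forall>\<^sub>F n in F. f n \<in> topspace Y) \<and> ((\<lambda>n. N (f n - x)) \<longlongrightarrow> 0) F"
proof -
  have "((\<lambda>n. d (f n) x) \<longlongrightarrow> 0) F \<longleftrightarrow> ((\<lambda>n. N (f n - x)) \<longlongrightarrow> 0) F"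
    if "x \<in> topspace Y" "\<forall>\<^sub>F n in F. f n \<in> topspace Y"
    by (intro tendsto_cong eventually_mono [OF that(2)]) (simp add: d_eq_N that)
  then show ?thesis
    using limitin_metric_dist_null [of f x F] by (auto simp: mtopology)
qed

lemma N_le_limit:
  assumes "limitin Y f x F" "\<forall>\<^sub>F n in F. N (f n) \<le> r" "F \<noteq> bot"
  shows "N x \<le> r"
proof (rule tendsto_le [OF assms(3)])
  show "((\<lambda>n. r + N (f n - x)) \<longlongrightarrow> r) F"
    using assms(1) tendsto_add [OF tendsto_const, of "\<lambda>n. N (f n - x)" 0 F r]
    by (simp add: limitin_iff_N)
  have x: "x \<in> topspace Y" and "\<forall>\<^sub>F n in F. f n \<in> topspace Y"
    using assms(1) by (auto simp: limitin_iff_N)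
  from assms(2) this(2) show "\<forall>\<^sub>F n in F. N x \<le> r + N (f n - x)"
  proof eventually_elim
    case (elim n)
    then show ?case
      using N_triangle_diff [of "f n" "f n - x"] x by (simp add: in_topspace)
  qed
qed (rule tendsto_const)

lemma openin_iff_N:
  "openin Y U \<longleftrightarrow>
     U \<subseteq> topspace Y \<and> (\<forall>x\<in>U. \<exists>r>0. \<forall>y\<in>topspace Y. N (y - x) < r \<longrightarrow> y \<in> U)"
proof -
  have "(\<exists>r>0. mball x r \<subseteq> U) \<longleftrightarrow>
      (\<exists>r>0. \<forall>y\<in>topspace Y. N (y - x) < r \<longrightarrow> y \<in> U)" if "x \<in> topspace Y" for x
    using that by (intro ex_cong1 conj_cong refl) (auto simp: mball_def d_eq_N N_diff_commute subset_iff)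
  then show ?thesis
    using openin_mtopology [of U] unfolding mtopology by blast
qed

lemma scale_continuous_at:
  assumes "x \<in> topspace Y" "0 < \<rho>"
  obtains \<delta> where "0 < \<delta>"
    "\<And>c y. norm (c - t) < \<delta> \<Longrightarrow> y \<in> topspace Y \<Longrightarrow> N (y - x) < \<delta> \<Longrightarrow> N (s c y - s t x) < \<rho>"
proof -
  define W where "W = {y \<in> topspace Y. N (y - s t x) < \<rho>}"
  have "openin Y W"
    unfolding openin_iff_N
  proof (intro conjI ballI)
    fix y
    assume y: "y \<in> W"
    have "z \<in> W" if "z \<in> topspace Y" "N (z - y) < \<rho> - N (y - s t x)" for z
      using N_triangle [of "z - y" "y - s t x"] that y assms by (auto simp: W_def in_topspace)
    moreover have "0 < \<rho> - N (y - s t x)"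
      using y by (simp add: W_def)
    ultimately show "\<exists>r>0. \<forall>z\<in>topspace Y. N (z - y) < r \<longrightarrow> z \<in> W"
      by blast
  qed (auto simp: W_def)
  define P where "P = {p \<in> topspace (prod_topology euclidean Y). (case p of (c, y) \<Rightarrow> s c y) \<in> W}"
  have "openin (prod_topology euclidean Y) P"
    using tvs \<open>openin Y W\<close> by (simp add: P_def topological_vector_space_def continuous_map_def)
  moreover have "(t, x) \<in> P"
    using assms by (simp add: P_def W_def in_topspace)
  ultimately obtain A V where "openin euclidean A" "t \<in> A" and V: "openin Y V" "x \<in> V" and AV: "A \<times> V \<subseteq> P"
    unfolding openin_prod_topology_alt by meson
  then have A: "open A" "t \<in> A"
    by simp_all
  obtain \<delta>1 where \<delta>1: "0 < \<delta>1" "\<And>c. norm (c - t) < \<delta>1 \<Longrightarrow> c \<in> A"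
    using A unfolding open_dist dist_norm by blast
  obtain \<delta>2 where \<delta>2: "0 < \<delta>2" "\<And>y. y \<in> topspace Y \<Longrightarrow> N (y - x) < \<delta>2 \<Longrightarrow> y \<in> V"
    using V unfolding openin_iff_N by blast
  have "N (s c y - s t x) < \<rho>"
    if "norm (c - t) < min \<delta>1 \<delta>2" "y \<in> topspace Y" "N (y - x) < min \<delta>1 \<delta>2" for c y
  proof -
    have "(c, y) \<in> A \<times> V"
      using \<delta>1(2) [of c] \<delta>2(2) [of y] that by auto
    with AV have "s c y \<in> W"
      by (auto simp: P_def)
    then show ?thesis
      by (simp add: W_def)
  qed
  moreover have "0 < min \<delta>1 \<delta>2"
    using \<delta>1(1) \<delta>2(1) by simp
  ultimately show ?thesis
    using that by blast
qed

text \<open>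
  Bounded sets of scalars act equicontinuously. Multiplication by the fixed scalar \<open>R\<close> reduces this
  to the continuity of the scalar multiplication at \<open>(0, 0)\<close>.
\<close>

lemma scale_bounded_small:
  assumes "0 < \<rho>"
  obtains \<delta> where "0 < \<delta>"
    "\<And>c y. norm c \<le> M \<Longrightarrow> y \<in> topspace Y \<Longrightarrow> N y < \<delta> \<Longrightarrow> N (s c y) < \<rho>"
proof -
  obtain \<eta> where \<eta>: "0 < \<eta>"
    "\<And>c y. norm (c - 0) < \<eta> \<Longrightarrow> y \<in> topspace Y \<Longrightarrow> N (y - 0) < \<eta> \<Longrightarrow> N (s c y - s 0 0) < \<rho>"
    using scale_continuous_at [OF zero_in assms] by blast
  define R :: real where "R = 2 * (\<bar>M\<bar> + 1) / \<eta>"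
  have R: "0 < R"
    using \<eta>(1) by (simp add: R_def)
  obtain \<delta> where \<delta>: "0 < \<delta>"
    "\<And>c y. norm (c - of_real R) < \<delta> \<Longrightarrow> y \<in> topspace Y \<Longrightarrow> N (y - 0) < \<delta> \<Longrightarrow>
       N (s c y - s (of_real R) 0) < \<eta>"
    using scale_continuous_at [OF zero_in \<eta>(1)] by blast
  have "N (s c y) < \<rho>" if "norm c \<le> M" "y \<in> topspace Y" "N y < \<delta>" for c y
  proof -
    have "norm c < \<eta> * R"
      using that(1) \<eta>(1) by (simp add: R_def)
    then have "norm (c / of_real R) < \<eta>"
      using R by (simp add: norm_divide divide_simps)
    moreover have "N (s (of_real R) y) < \<eta>"
      using \<delta>(2) [of "of_real R" y] \<delta>(1) that by simp
    ultimately have "N (s (c / of_real R) (s (of_real R) y)) < \<rho>"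
      using \<eta>(2) [of "c / of_real R" "s (of_real R) y"] that by (simp add: scale_in)
    then show ?thesis
      using R by simp
  qed
  with \<delta>(1) that show ?thesis
    by blast
qed

lemma scale_small_imp_scalar_small:
  assumes "x \<in> topspace Y" "x \<noteq> 0" "0 < \<epsilon>"
  obtains \<delta> where "0 < \<delta>" "\<And>c. N (s c x) < \<delta> \<Longrightarrow> norm c < \<epsilon>"
proof -
  have "0 < N x"
    using assms N_eq_0_iff by (metis N_ge_0 less_eq_real_def)
  then obtain \<delta> where \<delta>: "0 < \<delta>"
    "\<And>c y. norm c \<le> 1 / \<epsilon> \<Longrightarrow> y \<in> topspace Y \<Longrightarrow> N y < \<delta> \<Longrightarrow> N (s c y) < N x"
    using scale_bounded_small by blast
  have "norm c < \<epsilon>" if "N (s c x) < \<delta>" for c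
  proof (rule ccontr)
    assume "\<not> norm c < \<epsilon>"
    then have c: "c \<noteq> 0" "norm (1 / c) \<le> 1 / \<epsilon>"
      using assms(3) by (auto simp: norm_divide divide_simps)
    have "N (s (1 / c) (s c x)) < N x"
      by (intro \<delta>(2) c that scale_in assms)
    with c show False
      by simp
  qed
  with \<delta>(1) that show ?thesis
    by blast
qed

end


text \<open>
  An F-space with a Schauder basis \<open>e\<close>, where \<open>c x j\<close> is the \<open>j\<close>-th coordinate of \<open>x\<close>. The coordinates
  are a parameter, so that all steps of an inductive spectrum can share them. Their continuity is
  not assumed.
\<close>

locale F_space_basis = F_space s Y d
  for s :: "'k::real_or_complex_field \<Rightarrow> 'a::ab_group_add \<Rightarrow> 'a"
    and Y :: "'a topology" and d :: "'a \<Rightarrow> 'a \<Rightarrow> real" +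
  fixes e :: "nat \<Rightarrow> 'a" and c :: "'a \<Rightarrow> nat \<Rightarrow> 'k"
  assumes basis_in: "e j \<in> topspace Y"
    and expansion: "x \<in> topspace Y \<Longrightarrow> limitin Y (\<lambda>n. \<Sum>j<n. s (c x j) (e j)) x sequentially"
    and coord_unique: "limitin Y (\<lambda>n. \<Sum>j<n. s (a j) (e j)) x sequentially \<Longrightarrow> c x = a"
begin

text \<open>The partial sum operators of the basis.\<close>

definition P :: "nat \<Rightarrow> 'a \<Rightarrow> 'a" where
  "P n x = (\<Sum>j<n. s (c x j) (e j))"

lemma P_in: "P n x \<in> topspace Y"
  unfolding P_def by (intro sum_in scale_in basis_in)

lemma expansion_P: "x \<in> topspace Y \<Longrightarrow> limitin Y (\<lambda>n. P n x) x sequentially"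
  unfolding P_def by (rule expansion)

lemma coord_add:
  assumes "x \<in> topspace Y" "y \<in> topspace Y"
  shows "c (x + y) = (\<lambda>j. c x j + c y j)"
  using limitin_add [OF expansion expansion, OF assms]
  by (intro coord_unique) (simp add: scale_left_distrib sum.distrib)

lemma coord_scale:
  assumes "x \<in> topspace Y"
  shows "c (s t x) = (\<lambda>j. t * c x j)"
  using limitin_scale [OF tendsto_const expansion [OF assms], of t]
  by (intro coord_unique) (simp add: scale_sum_right)

lemma coord_diff:
  assumes "x \<in> topspace Y" "y \<in> topspace Y"
  shows "c (x - y) = (\<lambda>j. c x j - c y j)"
  using limitin_diff [OF expansion expansion, OF assms]
  by (intro coord_unique) (simp add: scale_left_diff_distrib sum_subtractf)

lemma coord_zero: "c 0 = (\<lambda>j. 0)"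
  by (intro coord_unique) (simp add: zero_in)

lemma P_zero [simp]: "P n 0 = 0"
  by (simp add: P_def coord_zero)

lemma P_diff:
  assumes "x \<in> topspace Y" "y \<in> topspace Y"
  shows "P n (x - y) = P n x - P n y"
  by (simp add: P_def coord_diff [OF assms] scale_left_diff_distrib sum_subtractf)

lemma P_scale:
  assumes "x \<in> topspace Y"
  shows "P n (s t x) = s t (P n x)"
  by (simp add: P_def coord_scale [OF assms] scale_sum_right)

lemma coord_finite_sum: "c (\<Sum>i<n. s (a i) (e i)) = (\<lambda>j. if j < n then a j else 0)"
proof (rule coord_unique)
  have "\<forall>\<^sub>F k in sequentially.
    (\<Sum>j<k. s (if j < n then a j else 0) (e j)) = (\<Sum>i<n. s (a i) (e i))"
    using eventually_ge_at_top [of n]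
    by eventually_elim (rule sum.mono_neutral_cong_right; auto)
  then show "limitin Y (\<lambda>k. \<Sum>j<k. s (if j < n then a j else 0) (e j)) (\<Sum>i<n. s (a i) (e i)) sequentially"
    by (intro limitin_eventually sum_in scale_in basis_in)
qed

lemma basis_nonzero: "e i \<noteq> 0"
proof
  assume "e i = 0"
  then have "(\<Sum>j<n. s (if j = i then 1 else 0) (e j)) = 0" for n
    by (intro sum.neutral) auto
  then have "c 0 = (\<lambda>j. if j = i then 1 else 0)"
    by (intro coord_unique) (simp add: zero_in)
  then show False
    by (metis coord_zero zero_neq_one)
qed

lemma P_Suc_diff: "P (Suc n) x - P n x = s (c x n) (e n)"
  by (simp add: P_def)

text \<open>
  The closed ball of radius \<open>r\<close> around \<open>0\<close> for the stronger F-norm that maps \<open>x\<close> to the supremum of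
  \<open>N (P n x)\<close> over all \<open>n\<close>.
\<close>

definition sup_ball :: "real \<Rightarrow> 'a set" where
  "sup_ball r = {x \<in> topspace Y. \<forall>n. N (P n x) \<le> r}"

text \<open>
  The partial sums of \<open>x\<close> form a bounded set: all but finitely many of them are so close to \<open>x\<close> that
  continuity of the scalar multiplication at \<open>(0, x)\<close> applies to them.
\<close>

lemma sup_ball_absorbing:
  assumes "x \<in> topspace Y" "0 < r"
  obtains k :: nat where "k \<noteq> 0" "s (inverse (of_nat k)) x \<in> sup_ball r"
proof -
  have ev: "\<forall>\<^sub>F k in sequentially. norm (inverse (of_nat k) :: 'k) < \<delta>" if "0 < \<delta>" for \<delta> :: real
    using tendsto_inverse_0_at_top [OF filterlim_real_sequentially] that
    by (auto simp: norm_inverse norm_of_nat tendsto_iff elim: eventually_mono)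
  obtain \<delta> where \<delta>: "0 < \<delta>"
    "\<And>t y. norm (t - 0) < \<delta> \<Longrightarrow> y \<in> topspace Y \<Longrightarrow> N (y - x) < \<delta> \<Longrightarrow> N (s t y - s 0 x) < r"
    using scale_continuous_at [OF assms] by blast
  have "(\<lambda>n. N (P n x - x)) \<longlonglongrightarrow> 0"
    using expansion_P [OF assms(1)] by (simp add: limitin_iff_N)
  then have "\<forall>\<^sub>F n in sequentially. N (P n x - x) < \<delta>"
    using \<delta>(1) by (simp add: order_tendstoD)
  then obtain n0 where n0: "\<And>n. n \<ge> n0 \<Longrightarrow> N (P n x - x) < \<delta>"
    by (auto simp: eventually_sequentially)
  have tail: "\<forall>\<^sub>F k in sequentially. \<forall>n\<ge>n0. N (s (inverse (of_nat k)) (P n x)) \<le> r"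
    using ev [OF \<delta>(1)]
  proof eventually_elim
    case (elim k)
    then show ?case
      using \<delta>(2) [of "inverse (of_nat k)" "P _ x"] n0 P_in by (auto intro!: less_imp_le)
  qed
  have "\<forall>\<^sub>F k in sequentially. N (s (inverse (of_nat k)) (P n x)) \<le> r" for n
  proof -
    obtain \<eta> where \<eta>: "0 < \<eta>"
      "\<And>t y. norm (t - 0) < \<eta> \<Longrightarrow> y \<in> topspace Y \<Longrightarrow> N (y - P n x) < \<eta> \<Longrightarrow> N (s t y - s 0 (P n x)) < r"
      using scale_continuous_at [OF P_in assms(2)] by blast
    show ?thesis
      using ev [OF \<eta>(1)]
    proof eventually_elim
      case (elim k)
      then show ?case
        using \<eta>(2) [of "inverse (of_nat k)" "P n x"] \<eta>(1) P_in by simp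
    qed
  qed
  then have "\<forall>\<^sub>F k in sequentially. \<forall>n\<in>{..<n0}. N (s (inverse (of_nat k)) (P n x)) \<le> r"
    by (intro eventually_ball_finite) auto
  with tail have "\<forall>\<^sub>F k in sequentially. s (inverse (of_nat k)) x \<in> sup_ball r"
  proof eventually_elim
    case (elim k)
    then show ?case
      using assms by (auto simp: sup_ball_def scale_in P_scale) (meson lessThan_iff not_le)
  qed
  then have "\<forall>\<^sub>F k in sequentially. k \<noteq> 0 \<and> s (inverse (of_nat k)) x \<in> sup_ball r"
    using eventually_gt_at_top [of 0] by eventually_elim simp
  then obtain k where "k \<noteq> 0 \<and> s (inverse (of_nat k)) x \<in> sup_ball r"
    unfolding eventually_sequentially by blast
  then show ?thesis
    using that by blast
qed

lemma sup_ball_diff: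
  assumes "x \<in> sup_ball r" "y \<in> sup_ball r"
  shows "x - y \<in> sup_ball (2 * r)"
proof -
  have "N (P n (x - y)) \<le> 2 * r" for n
  proof -
    have "N (P n x - P n y) \<le> N (P n x) + N (P n y)"
      by (intro N_triangle_diff P_in)
    also have "\<dots> \<le> r + r"
      using assms by (intro add_mono) (auto simp: sup_ball_def)
    finally show ?thesis
      using assms by (simp add: sup_ball_def P_diff)
  qed
  then show ?thesis
    using assms by (simp add: sup_ball_def in_topspace)
qed

text \<open>
  The closure of \<open>sup_ball r\<close> is a neighbourhood of \<open>0\<close>: the multiples of \<open>sup_ball (r/2)\<close> by positive
  integers cover the space, so by Baire the closure of one of them contains a ball around a point
  \<open>x0\<close>, and differences of elements of \<open>sup_ball (r/2)\<close> are in \<open>sup_ball r\<close>.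
\<close>

lemma sup_ball_nearly_neighbourhood:
  assumes "0 < r"
  obtains \<delta> where "0 < \<delta>"
    "\<And>x \<epsilon>. x \<in> topspace Y \<Longrightarrow> N x < \<delta> \<Longrightarrow> 0 < \<epsilon> \<Longrightarrow> \<exists>y\<in>sup_ball r. N (x - y) < \<epsilon>"
proof -
  define G where "G k = Y closure_of (s (of_nat (Suc k)) ` sup_ball (r/2))" for k
  have "x \<in> (\<Union>k. G k)" if x: "x \<in> topspace Y" for x
  proof -
    obtain k :: nat where k: "k \<noteq> 0" "s (inverse (of_nat k)) x \<in> sup_ball (r/2)"
      using sup_ball_absorbing [OF x, of "r/2"] assms by auto
    then obtain k' where k': "k = Suc k'"
      by (cases k) auto
    have "x = s (of_nat (Suc k')) (s (inverse (of_nat k)) x)"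
      using k(1) unfolding k' by (simp del: of_nat_Suc)
    then have "x \<in> s (of_nat (Suc k')) ` sup_ball (r/2)"
      using k(2) by blast
    moreover have "s (of_nat (Suc k')) ` sup_ball (r/2) \<subseteq> topspace Y"
      by (auto simp: sup_ball_def scale_in)
    ultimately show ?thesis
      using closure_of_subset unfolding G_def by blast
  qed
  then have "(\<Union>k. G k) = topspace Y"
    using closure_of_subset_topspace [of Y] by (auto simp: G_def)
  then have "Y interior_of \<Union>(range G) \<noteq> {}"
    using zero_in by auto
  then obtain k where k: "Y interior_of G k \<noteq> {}"
    using metric_Baire_category_alt [OF complete, of "range G"] closedin_closure_of
    unfolding mtopology G_def by blast
  then obtain x0 \<rho> where x0: "x0 \<in> topspace Y" "0 < \<rho>"
      and ball: "\<And>y. y \<in> topspace Y \<Longrightarrow> N (y - x0) < \<rho> \<Longrightarrow> y \<in> G k"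
    using openin_interior_of [of Y "G k"] interior_of_subset [of Y "G k"]
    unfolding openin_iff_N by blast
  have dense: "\<exists>z\<in>sup_ball (r/2). N (y - s (of_nat (Suc k)) z) < \<eta>" if y: "y \<in> G k" and \<eta>: "0 < \<eta>" for y \<eta>
  proof -
    have "y \<in> mtopology closure_of (s (of_nat (Suc k)) ` sup_ball (r/2))"
      using y by (simp add: G_def mtopology)
    then obtain z where z: "z \<in> sup_ball (r/2)" "y \<in> topspace Y" "d y (s (of_nat (Suc k)) z) < \<eta>"
      using \<eta> unfolding metric_closure_of by auto
    then show ?thesis
      by (auto simp: d_eq_N sup_ball_def scale_in)
  qed
  obtain \<delta> where \<delta>: "0 < \<delta>"
    "\<And>t y. norm t \<le> norm (of_nat (Suc k) :: 'k) \<Longrightarrow> y \<in> topspace Y \<Longrightarrow> N y < \<delta> \<Longrightarrow> N (s t y) < \<rho>"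
    using scale_bounded_small [OF x0(2)] by blast
  have "\<exists>y\<in>sup_ball r. N (x - y) < \<epsilon>" if x: "x \<in> topspace Y" "N x < \<delta>" and \<epsilon>: "0 < \<epsilon>" for x \<epsilon>
  proof -
    define K :: 'k where "K = of_nat (Suc k)"
    have K: "K \<noteq> 0"
      unfolding K_def by (simp del: of_nat_Suc)
    obtain \<eta> where \<eta>: "0 < \<eta>"
      "\<And>t y. norm t \<le> norm (inverse K) \<Longrightarrow> y \<in> topspace Y \<Longrightarrow> N y < \<eta> \<Longrightarrow> N (s t y) < \<epsilon>"
      using scale_bounded_small [OF \<epsilon>] by blast
    have "N (s K x) < \<rho>"
      using \<delta>(2) [of K x] x by (simp add: K_def)
    then have "x0 + s K x \<in> G k" "x0 \<in> G k"
      using x0 x by (auto intro!: ball simp: in_topspace)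
    then obtain y1 y2 where y1: "y1 \<in> sup_ball (r/2)" "N (x0 + s K x - s K y1) < \<eta> / 2"
        and y2: "y2 \<in> sup_ball (r/2)" "N (x0 - s K y2) < \<eta> / 2"
      using dense [of _ "\<eta> / 2"] \<eta>(1) unfolding K_def by (meson half_gt_zero)
    have in_Y: "y1 \<in> topspace Y" "y2 \<in> topspace Y"
      using y1 y2 by (auto simp: sup_ball_def)
    have "s K (x - (y1 - y2)) = (x0 + s K x - s K y1) - (x0 - s K y2)"
      by (simp add: scale_right_diff_distrib)
    also have "N \<dots> \<le> N (x0 + s K x - s K y1) + N (x0 - s K y2)"
      using x0 x in_Y by (intro N_triangle_diff in_topspace)
    also have "\<dots> < \<eta>"
      using y1 y2 by simp
    finally have "N (s (inverse K) (s K (x - (y1 - y2)))) < \<epsilon>"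
      using x in_Y by (intro \<eta>(2)) (auto intro: in_topspace)
    then have "N (x - (y1 - y2)) < \<epsilon>"
      using K by simp
    moreover have "y1 - y2 \<in> sup_ball r"
      using sup_ball_diff [OF y1(1) y2(1)] by simp
    ultimately show ?thesis
      by blast
  qed
  with \<delta>(1) that show ?thesis
    by blast
qed

text \<open>
  If \<open>x\<close> is the sum of a series whose \<open>k\<close>-th term \<open>y k - y (Suc k)\<close> is in \<open>sup_ball (r / 2 ^ Suc k)\<close>,
  then \<open>x\<close> is in \<open>sup_ball r\<close>. The coordinates not being known to be continuous, those of \<open>x\<close> are
  found as the limits \<open>b j\<close> of the coordinates of the partial sums \<open>u k\<close> of this series: these are
  Cauchy sequences, and the estimates are uniform in the number \<open>n\<close> of coordinates, so that the
  expansion with coefficients \<open>b\<close> converges to \<open>x\<close>.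
\<close>

lemma in_sup_ball_if_approximable:
  assumes x: "x \<in> topspace Y" and r: "0 < r"
    and y: "y 0 = x" "\<And>k. y k \<in> topspace Y" "\<And>k. y k - y (Suc k) \<in> sup_ball (r / 2 ^ Suc k)"
    and y_lim: "(\<lambda>k. N (y k)) \<longlonglongrightarrow> 0"
  shows "x \<in> sup_ball r"
proof -
  define u where "u k = x - y k" for k
  have u_in: "u k \<in> topspace Y" for k
    using x y by (simp add: u_def in_topspace)
  have increment: "N (P n (u (Suc k)) - P n (u k)) \<le> r / 2 ^ Suc k" for n k
  proof -
    have "u (Suc k) - u k = y k - y (Suc k)"
      by (simp add: u_def)
    then show ?thesis
      using y(3) [of k] u_in by (simp add: sup_ball_def flip: P_diff)
  qed
  have tail: "N (P n (u l) - P n (u k)) \<le> r / 2 ^ k" if "k \<le> l" for n k l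
  proof -
    have "N (P n (u l) - P n (u k)) \<le> r / 2 ^ k - r / 2 ^ l"
      using that
    proof (induction l rule: dec_induct)
      case (step l)
      have "N ((P n (u (Suc l)) - P n (u l)) + (P n (u l) - P n (u k))) \<le>
          N (P n (u (Suc l)) - P n (u l)) + N (P n (u l) - P n (u k))"
        by (intro N_triangle in_topspace P_in)
      with step.IH increment [of n l] show ?case
        by simp
    qed simp
    moreover have "0 \<le> r / 2 ^ l"
      using r by simp
    ultimately show ?thesis
      by linarith
  qed
  have "convergent (\<lambda>k. c (u k) j)" for j
  proof (rule real_or_complex_Cauchy_convergent, rule CauchyI')
    fix \<epsilon> :: real
    assume "0 < \<epsilon>"
    then obtain \<delta> where \<delta>: "0 < \<delta>" "\<And>t. N (s t (e j)) < \<delta> \<Longrightarrow> norm t < \<epsilon>"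
      using scale_small_imp_scalar_small [OF basis_in basis_nonzero] by blast
    have "\<forall>\<^sub>F k in sequentially. 2 * (r / 2 ^ k) < \<delta>"
      using order_tendstoD(2) [OF LIMSEQ_divide_realpow_zero [of 2 "2 * r"] \<delta>(1)] by simp
    then obtain k0 where k0: "\<And>k. k \<ge> k0 \<Longrightarrow> 2 * (r / 2 ^ k) < \<delta>"
      by (auto simp: eventually_sequentially)
    have "norm (c (u k) j - c (u l) j) < \<epsilon>" if "k0 \<le> k" "k < l" for k l
    proof -
      define z where "z = u l - u k"
      have z: "z \<in> topspace Y" "N (P n z) \<le> r / 2 ^ k" for n
        using tail [of k l n] that u_in by (auto simp: z_def in_topspace P_diff)
      have "N (s (c z j) (e j)) \<le> N (P (Suc j) z) + N (P j z)"
        unfolding P_Suc_diff [symmetric] by (intro N_triangle_diff P_in)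
      also have "\<dots> < \<delta>"
        using z(2) [of j] z(2) [of "Suc j"] k0 [OF that(1)] by simp
      finally have "norm (c z j) < \<epsilon>"
        by (rule \<delta>(2))
      then show ?thesis
        using u_in by (simp add: z_def coord_diff norm_minus_commute)
    qed
    then show "\<exists>M. \<forall>m\<ge>M. \<forall>n>m. dist (c (u m) j) (c (u n) j) < \<epsilon>"
      unfolding dist_norm by blast
  qed
  then have "\<exists>b. \<forall>j. (\<lambda>k. c (u k) j) \<longlonglongrightarrow> b j"
    by (intro choice allI) (simp add: convergent_def)
  then obtain b where b: "\<And>j. (\<lambda>k. c (u k) j) \<longlonglongrightarrow> b j"
    by blast
  define Q where "Q n = (\<Sum>j<n. s (b j) (e j))" for n
  have Q_in: "Q n \<in> topspace Y" for n
    unfolding Q_def by (intro sum_in scale_in basis_in)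
  have "limitin Y (\<lambda>k. P n (u k)) (Q n) sequentially" for n
    unfolding P_def Q_def
    by (intro limitin_sum limitin_scale b) (simp add: basis_in)
  have P_Q: "N (Q n - P n (u k)) \<le> r / 2 ^ k" for n k
  proof (rule N_le_limit)
    show "limitin Y (\<lambda>l. P n (u l) - P n (u k)) (Q n - P n (u k)) sequentially"
      by (intro limitin_diff) (use \<open>limitin Y (\<lambda>k. P n (u k)) (Q n) sequentially\<close> P_in in auto)
    show "\<forall>\<^sub>F l in sequentially. N (P n (u l) - P n (u k)) \<le> r / 2 ^ k"
      by (rule eventually_mono [OF eventually_ge_at_top tail])
  qed simp
  have "limitin Y Q x sequentially"
    unfolding limitin_iff_N
  proof (intro conjI x)
    show "(\<lambda>n. N (Q n - x)) \<longlonglongrightarrow> 0"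
    proof (rule tendstoI)
      fix \<epsilon> :: real
      assume \<epsilon>: "0 < \<epsilon>"
      have "\<forall>\<^sub>F k in sequentially. r / 2 ^ k < \<epsilon> / 3"
        using order_tendstoD(2) [OF LIMSEQ_divide_realpow_zero [of 2 r], of "\<epsilon> / 3"] \<epsilon> by simp
      moreover have "\<forall>\<^sub>F k in sequentially. N (y k) < \<epsilon> / 3"
        using order_tendstoD(2) [OF y_lim, of "\<epsilon> / 3"] \<epsilon> by simp
      ultimately have "\<forall>\<^sub>F k in sequentially. r / 2 ^ k < \<epsilon> / 3 \<and> N (y k) < \<epsilon> / 3"
        by (rule eventually_conj)
      then obtain k where k: "r / 2 ^ k < \<epsilon> / 3" "N (y k) < \<epsilon> / 3"
        unfolding eventually_sequentially by blast
      have "(\<lambda>n. N (P n (u k) - u k)) \<longlonglongrightarrow> 0"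
        using expansion_P [OF u_in] by (simp add: limitin_iff_N)
      from order_tendstoD(2) [OF this, of "\<epsilon> / 3"]
      have "\<forall>\<^sub>F n in sequentially. N (P n (u k) - u k) < \<epsilon> / 3"
        using \<epsilon> by simp
      then show "\<forall>\<^sub>F n in sequentially. dist (N (Q n - x)) 0 < \<epsilon>"
      proof eventually_elim
        case (elim n)
        have "Q n - x = (Q n - P n (u k)) + ((P n (u k) - u k) - y k)"
          by (simp add: u_def)
        also have "N \<dots> \<le> N (Q n - P n (u k)) + (N (P n (u k) - u k) + N (y k))"
          by (rule order_trans [OF N_triangle add_left_mono [OF N_triangle_diff]])
            (auto intro!: in_topspace P_in Q_in u_in y)
        also have "\<dots> < \<epsilon>"
          using P_Q [of n k] k elim by linarith
        finally show ?case
          by simp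
      qed
    qed
  qed (simp add: Q_in)
  then have "c x = b"
    unfolding Q_def by (rule coord_unique)
  then have "P n x = Q n" for n
    by (simp add: P_def Q_def)
  moreover have "u 0 = 0"
    by (simp add: u_def y)
  ultimately have "N (P n x) \<le> r" for n
    using P_Q [of n 0] by simp
  then show ?thesis
    using x by (simp add: sup_ball_def)
qed

text \<open>
  The partial sum operators are equicontinuous. Points \<open>y k\<close> as in \<open>in_sup_ball_if_approximable\<close> are
  chosen one after the other, with \<open>y k\<close> so close to \<open>0\<close> that it can be approximated in turn by elements
  of \<open>sup_ball (r / 2 ^ Suc k)\<close>.
\<close>

lemma sup_ball_neighbourhood:
  assumes r: "0 < r"
  obtains \<delta> where "0 < \<delta>" "\<And>x. x \<in> topspace Y \<Longrightarrow> N x < \<delta> \<Longrightarrow> x \<in> sup_ball r"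
proof -
  have "\<exists>\<delta>>0. \<forall>x\<in>topspace Y. N x < \<delta> \<longrightarrow> (\<forall>\<epsilon>>0. \<exists>y\<in>sup_ball (r / 2 ^ Suc k). N (x - y) < \<epsilon>)" for k
    using sup_ball_nearly_neighbourhood [of "r / 2 ^ Suc k"] r by (metis divide_pos_pos zero_less_power zero_less_numeral)
  then obtain \<delta> where \<delta>: "\<And>k. 0 < \<delta> k"
    "\<And>k x \<epsilon>. x \<in> topspace Y \<Longrightarrow> N x < \<delta> k \<Longrightarrow> 0 < \<epsilon> \<Longrightarrow> \<exists>y\<in>sup_ball (r / 2 ^ Suc k). N (x - y) < \<epsilon>"
    by metis
  have "x \<in> sup_ball r" if x: "x \<in> topspace Y" "N x < \<delta> 0" for x
  proof -
    define R where "R k y \<longleftrightarrow> y \<in> topspace Y \<and> N y < \<delta> k \<and> (k = 0 \<longrightarrow> y = x) \<and>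
      (k \<noteq> 0 \<longrightarrow> N y < inverse (real k))" for k y
    have "\<exists>y. \<forall>k. R k (y k) \<and> y k - y (Suc k) \<in> sup_ball (r / 2 ^ Suc k)"
    proof (rule dependent_nat_choice)
      show "\<exists>y. R 0 y"
        using x by (auto simp: R_def)
    next
      fix y k
      assume y: "R k y"
      have "0 < min (\<delta> (Suc k)) (inverse (real (Suc k)))"
        using \<delta>(1) by simp
      then obtain z where z: "z \<in> sup_ball (r / 2 ^ Suc k)" "N (y - z) < min (\<delta> (Suc k)) (inverse (real (Suc k)))"
        using \<delta>(2) [of y k] y unfolding R_def by blast
      then have "R (Suc k) (y - z)"
        using y by (auto simp: R_def sup_ball_def in_topspace)
      moreover have "y - (y - z) \<in> sup_ball (r / 2 ^ Suc k)"
        using z by simp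
      ultimately show "\<exists>z. R (Suc k) z \<and> y - z \<in> sup_ball (r / 2 ^ Suc k)"
        by blast
    qed
    then obtain y where y: "\<And>k. R k (y k)" "\<And>k. y k - y (Suc k) \<in> sup_ball (r / 2 ^ Suc k)"
      by blast
    have "(\<lambda>k. N (y k)) \<longlonglongrightarrow> 0"
    proof (rule tendsto_sandwich [OF _ _ tendsto_const])
      show "\<forall>\<^sub>F k in sequentially. N (y k) \<le> inverse (real k)"
        using eventually_gt_at_top [of 0]
        by eventually_elim (use y(1) in \<open>auto simp: R_def intro: less_imp_le\<close>)
      show "(\<lambda>k. inverse (real k)) \<longlonglongrightarrow> 0"
        by (rule lim_inverse_n)
    qed simp
    moreover have "y 0 = x" "\<And>k. y k \<in> topspace Y"
      using y(1) by (auto simp: R_def)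
    ultimately show ?thesis
      using in_sup_ball_if_approximable x r y(2) by blast
  qed
  with \<delta>(1) that show ?thesis
    by blast
qed

lemma no_null_subsequence_imp_bounded_below:
  assumes "\<And>j :: nat \<Rightarrow> nat. strict_mono j \<Longrightarrow> range j \<subseteq> J \<Longrightarrow>
    \<not> limitin Y (\<lambda>k. e (j k)) 0 sequentially"
  obtains \<epsilon> where "0 < \<epsilon>" "\<And>i. i \<in> J \<Longrightarrow> \<epsilon> \<le> N (e i)"
proof (rule ccontr)
  assume "\<not> thesis"
  then have small: "\<exists>i\<in>J. N (e i) < \<epsilon>" if "0 < \<epsilon>" for \<epsilon>
    using that by (meson not_le \<open>\<And>\<epsilon>. \<lbrakk>0 < \<epsilon>; \<And>i. i \<in> J \<Longrightarrow> \<epsilon> \<le> N (e i)\<rbrakk> \<Longrightarrow> thesis\<close>)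
  have later: "\<exists>i\<in>J. n < i \<and> N (e i) < \<epsilon>" if "0 < \<epsilon>" for \<epsilon> n
  proof -
    \<comment> \<open>As the \<open>N (e i)\<close> with \<open>i \<le> n\<close> are positive, so is \<open>\<eta>\<close>, and \<open>N (e i) < \<eta>\<close> implies \<open>n < i\<close>.\<close>
    define \<eta> where "\<eta> = Min (insert \<epsilon> ((\<lambda>i. N (e i)) ` {..n}))"
    have "0 < N (e i)" for i
      using N_eq_0_iff [OF basis_in] basis_nonzero by (metis N_ge_0 less_eq_real_def)
    then have "0 < \<eta>"
      using that by (auto simp: \<eta>_def)
    then obtain i where "i \<in> J" "N (e i) < \<eta>"
      using small by blast
    moreover have "\<eta> \<le> \<epsilon>" "\<And>i. i \<le> n \<Longrightarrow> \<eta> \<le> N (e i)"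
      unfolding \<eta>_def by (rule Min_le; simp)+
    ultimately have "i \<in> J" "n < i" "N (e i) < \<epsilon>"
      by (force simp: not_le [symmetric])+
    then show ?thesis
      by blast
  qed
  have "\<exists>j. \<forall>k. (j k \<in> J \<and> N (e (j k)) < inverse (real (Suc k))) \<and> j k < j (Suc k)"
  proof (rule dependent_nat_choice)
    show "\<exists>i. i \<in> J \<and> N (e i) < inverse (real (Suc 0))"
      using later [of "inverse (real (Suc 0))"] by auto
    show "\<exists>i. (i \<in> J \<and> N (e i) < inverse (real (Suc (Suc k)))) \<and> n < i" for n k
      using later [of "inverse (real (Suc (Suc k)))" n] by auto
  qed
  then obtain j where j: "\<And>k. j k \<in> J" "\<And>k. N (e (j k)) < inverse (real (Suc k))" "\<And>k. j k < j (Suc k)"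
    by blast
  have "(\<lambda>k. N (e (j k))) \<longlonglongrightarrow> 0"
    by (rule tendsto_sandwich [OF _ _ tendsto_const LIMSEQ_inverse_real_of_nat])
      (use j(2) in \<open>auto intro!: always_eventually less_imp_le\<close>)
  then have "limitin Y (\<lambda>k. e (j k)) 0 sequentially"
    by (simp add: limitin_iff_N basis_in zero_in)
  moreover have "strict_mono j"
    by (simp add: strict_mono_Suc_iff j)
  ultimately show False
    using assms j(1) by blast
qed

lemma coords_small_near_0:
  assumes "\<And>j :: nat \<Rightarrow> nat. strict_mono j \<Longrightarrow> range j \<subseteq> J \<Longrightarrow>
    \<not> limitin Y (\<lambda>k. e (j k)) 0 sequentially"
  obtains \<delta> where "0 < \<delta>"
    "\<And>x i. x \<in> topspace Y \<Longrightarrow> N x < \<delta> \<Longrightarrow> i \<in> J \<Longrightarrow> norm (c x i) < 1"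
proof -
  obtain \<epsilon> where \<epsilon>: "0 < \<epsilon>" "\<And>i. i \<in> J \<Longrightarrow> \<epsilon> \<le> N (e i)"
    using no_null_subsequence_imp_bounded_below assms by blast
  obtain \<eta> where \<eta>: "0 < \<eta>"
    "\<And>t y. norm t \<le> 1 \<Longrightarrow> y \<in> topspace Y \<Longrightarrow> N y < \<eta> \<Longrightarrow> N (s t y) < \<epsilon>"
    using scale_bounded_small [OF \<epsilon>(1)] by blast
  obtain \<delta> where \<delta>: "0 < \<delta>" "\<And>x. x \<in> topspace Y \<Longrightarrow> N x < \<delta> \<Longrightarrow> x \<in> sup_ball (\<eta>/3)"
    using sup_ball_neighbourhood [of "\<eta>/3"] \<eta>(1) by auto
  have "norm (c x i) < 1" if x: "x \<in> topspace Y" "N x < \<delta>" and i: "i \<in> J" for x i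
  proof (rule ccontr)
    assume "\<not> norm (c x i) < 1"
    then have c: "c x i \<noteq> 0" "norm (inverse (c x i)) \<le> 1"
      by (auto simp: norm_inverse inverse_le_1_iff)
    have "N (P (Suc i) x) \<le> \<eta>/3" "N (P i x) \<le> \<eta>/3"
      using \<delta>(2) [OF x] by (simp_all add: sup_ball_def)
    then have "N (P (Suc i) x) + N (P i x) < \<eta>"
      using \<eta>(1) by linarith
    moreover have "N (s (c x i) (e i)) \<le> N (P (Suc i) x) + N (P i x)"
      unfolding P_Suc_diff [symmetric] by (intro N_triangle_diff P_in)
    ultimately have "N (s (inverse (c x i)) (s (c x i) (e i))) < \<epsilon>"
      using c(2) by (intro \<eta>(2) scale_in basis_in) auto
    with c(1) \<epsilon>(2) [OF i] show False
      by simp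
  qed
  with \<delta>(1) that show ?thesis
    by blast
qed

end


section \<open>Continuous seminorms on inductive limits\<close>

text \<open>A seminorm \<open>p\<close> on the linear subspace \<open>E\<close>; the values of \<open>p\<close> outside of \<open>E\<close> are irrelevant.\<close>

locale seminormed_space = vector_space s
  for s :: "'k::real_or_complex_field \<Rightarrow> 'a::ab_group_add \<Rightarrow> 'a" +
  fixes E :: "'a set" and p :: "'a \<Rightarrow> real"
  assumes subspace_E: "subspace E"
    and p_triangle: "x \<in> E \<Longrightarrow> y \<in> E \<Longrightarrow> p (x + y) \<le> p x + p y"
    and p_scale: "x \<in> E \<Longrightarrow> p (s t x) = norm t * p x"
begin

lemma in_E:
  shows zero_in_E: "0 \<in> E"
    and add_in_E: "x \<in> E \<Longrightarrow> y \<in> E \<Longrightarrow> x + y \<in> E"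
    and diff_in_E: "x \<in> E \<Longrightarrow> y \<in> E \<Longrightarrow> x - y \<in> E"
    and scale_in_E: "x \<in> E \<Longrightarrow> s t x \<in> E"
  using subspace_E by (auto intro: subspace_0 subspace_add subspace_diff subspace_scale)

lemma p_zero [simp]: "p 0 = 0"
  using p_scale [OF zero_in_E, of 0] by simp

lemma p_minus: "x \<in> E \<Longrightarrow> p (- x) = p x"
  using p_scale [of x "- 1"] by simp

lemma p_nonneg: "x \<in> E \<Longrightarrow> 0 \<le> p x"
  using p_triangle [of x "- x"] p_minus [of x] scale_in_E [of x "- 1"] by simp

text \<open>The topology on \<open>E\<close> given by \<open>p\<close>; it is Hausdorff only if \<open>p\<close> is a norm.\<close>

definition seminorm_topology :: "'a topology" where
  "seminorm_topology =
     topology (\<lambda>U. U \<subseteq> E \<and> (\<forall>x\<in>U. \<exists>r>0. \<forall>y\<in>E. p (y - x) < r \<longrightarrow> y \<in> U))"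

lemma openin_seminorm_topology:
  "openin seminorm_topology U \<longleftrightarrow> U \<subseteq> E \<and> (\<forall>x\<in>U. \<exists>r>0. \<forall>y\<in>E. p (y - x) < r \<longrightarrow> y \<in> U)"
proof -
  have "istopology (\<lambda>U. U \<subseteq> E \<and> (\<forall>x\<in>U. \<exists>r>0. \<forall>y\<in>E. p (y - x) < r \<longrightarrow> y \<in> U))"
    unfolding istopology_def
  proof (intro conjI allI impI)
    fix U V
    assume U: "U \<subseteq> E \<and> (\<forall>x\<in>U. \<exists>r>0. \<forall>y\<in>E. p (y - x) < r \<longrightarrow> y \<in> U)"
      and V: "V \<subseteq> E \<and> (\<forall>x\<in>V. \<exists>r>0. \<forall>y\<in>E. p (y - x) < r \<longrightarrow> y \<in> V)"
    show "U \<inter> V \<subseteq> E"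
      using U by blast
    show "\<forall>x\<in>U \<inter> V. \<exists>r>0. \<forall>y\<in>E. p (y - x) < r \<longrightarrow> y \<in> U \<inter> V"
    proof
      fix x
      assume "x \<in> U \<inter> V"
      then obtain r r' where "0 < r" "\<forall>y\<in>E. p (y - x) < r \<longrightarrow> y \<in> U"
          "0 < r'" "\<forall>y\<in>E. p (y - x) < r' \<longrightarrow> y \<in> V"
        using U V by blast
      then show "\<exists>r>0. \<forall>y\<in>E. p (y - x) < r \<longrightarrow> y \<in> U \<inter> V"
        by (intro exI [of _ "min r r'"]) auto
    qed
  next
    fix \<K>
    assume "\<forall>U\<in>\<K>. U \<subseteq> E \<and> (\<forall>x\<in>U. \<exists>r>0. \<forall>y\<in>E. p (y - x) < r \<longrightarrow> y \<in> U)"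
    then show "\<Union>\<K> \<subseteq> E" "\<forall>x\<in>\<Union>\<K>. \<exists>r>0. \<forall>y\<in>E. p (y - x) < r \<longrightarrow> y \<in> \<Union>\<K>"
      by (blast, meson UnionE UnionI)
  qed
  then show ?thesis
    by (simp add: seminorm_topology_def)
qed

lemma topspace_seminorm_topology [simp]: "topspace seminorm_topology = E"
proof -
  have "openin seminorm_topology E"
    unfolding openin_seminorm_topology by (auto intro: zero_less_one)
  then show ?thesis
    by (metis openin_seminorm_topology openin_subset openin_topspace subset_antisym)
qed

lemma openin_seminorm_ball:
  assumes "x \<in> E"
  shows "openin seminorm_topology {y \<in> E. p (y - x) < r}"
  unfolding openin_seminorm_topology
proof (intro conjI ballI)
  fix y
  assume y: "y \<in> {y \<in> E. p (y - x) < r}"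
  have "p (z - x) < r" if "z \<in> E" "p (z - y) < r - p (y - x)" for z
    using p_triangle [of "z - y" "y - x"] that y assms by (simp add: in_E)
  with y show "\<exists>r'>0. \<forall>z\<in>E. p (z - y) < r' \<longrightarrow> z \<in> {y \<in> E. p (y - x) < r}"
    by (intro exI [of _ "r - p (y - x)"]) auto
qed auto

lemma continuous_add_seminorm_topology:
  "continuous_map (prod_topology seminorm_topology seminorm_topology) seminorm_topology (\<lambda>(x, y). x + y)"
  unfolding continuous_map_def
proof (intro conjI allI impI)
  fix U
  assume U: "openin seminorm_topology U"
  show "openin (prod_topology seminorm_topology seminorm_topology)
     {z \<in> topspace (prod_topology seminorm_topology seminorm_topology). (case z of (x, y) \<Rightarrow> x + y) \<in> U}"
    (is "openin _ ?S")
    unfolding openin_prod_topology_alt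
  proof (intro allI impI)
    fix x y
    assume "(x, y) \<in> ?S"
    then have xy: "x \<in> E" "y \<in> E" "x + y \<in> U"
      by auto
    then obtain r where r: "0 < r" "\<forall>z\<in>E. p (z - (x + y)) < r \<longrightarrow> z \<in> U"
      using U unfolding openin_seminorm_topology by blast
    define V where "V x = {x' \<in> E. p (x' - x) < r / 2}" for x
    have "x' + y' \<in> U" if "x' \<in> V x" "y' \<in> V y" for x' y'
    proof -
      have "p ((x' + y') - (x + y)) = p ((x' - x) + (y' - y))"
        by (simp add: algebra_simps)
      also have "\<dots> \<le> p (x' - x) + p (y' - y)"
        using that xy by (intro p_triangle) (auto simp: V_def in_E)
      also have "\<dots> < r"
        using that by (simp add: V_def)
      finally show ?thesis
        using r that by (simp add: V_def in_E)
    qed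
    then have "V x \<times> V y \<subseteq> ?S"
      by (auto simp: V_def)
    moreover have "openin seminorm_topology (V x)" "openin seminorm_topology (V y)" "x \<in> V x" "y \<in> V y"
      using xy r(1) openin_seminorm_ball [of _ "r / 2"] unfolding V_def by auto
    ultimately show "\<exists>V W. openin seminorm_topology V \<and> openin seminorm_topology W \<and>
        x \<in> V \<and> y \<in> W \<and> V \<times> W \<subseteq> ?S"
      by blast
  qed
qed (auto simp: in_E)

lemma continuous_scale_seminorm_topology:
  "continuous_map (prod_topology euclidean seminorm_topology) seminorm_topology (\<lambda>(t, x). s t x)"
  unfolding continuous_map_def
proof (intro conjI allI impI)
  fix U
  assume U: "openin seminorm_topology U"
  show "openin (prod_topology euclidean seminorm_topology)
     {z \<in> topspace (prod_topology euclidean seminorm_topology). (case z of (t, x) \<Rightarrow> s t x) \<in> U}"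
    (is "openin _ ?S")
    unfolding openin_prod_topology_alt
  proof (intro allI impI)
    fix t x
    assume "(t, x) \<in> ?S"
    then have x: "x \<in> E" "s t x \<in> U"
      by auto
    then obtain r where r: "0 < r" "\<forall>z\<in>E. p (z - s t x) < r \<longrightarrow> z \<in> U"
      using U unfolding openin_seminorm_topology by blast
    define \<delta> where "\<delta> = min 1 (r / (2 * (p x + 1)))"
    define \<eta> where "\<eta> = r / (2 * (norm t + 1))"
    have px: "0 \<le> p x"
      using x by (simp add: p_nonneg)
    have \<delta>: "0 < \<delta>" "\<delta> \<le> 1" "\<delta> * p x \<le> r / 2"
    proof -
      show "0 < \<delta>" "\<delta> \<le> 1"
        using r(1) px by (auto simp: \<delta>_def)
      have "\<delta> * p x \<le> r / (2 * (p x + 1)) * p x"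
        using px by (intro mult_right_mono) (auto simp: \<delta>_def)
      also have "\<dots> \<le> r / 2"
        using px r(1) by (simp add: field_simps)
      finally show "\<delta> * p x \<le> r / 2" .
    qed
    have "0 < norm t + 1"
      using norm_ge_zero [of t] by linarith
    then have \<eta>: "0 < \<eta>" "(norm t + 1) * \<eta> = r / 2"
      using r(1) by (simp_all only: \<eta>_def) (simp_all add: divide_simps)
    have "s u y \<in> U" if u: "u \<in> ball t \<delta>" and y: "y \<in> {y \<in> E. p (y - x) < \<eta>}" for u y
    proof -
      have u_t: "norm (u - t) < \<delta>"
        using u by (simp add: dist_norm norm_minus_commute)
      then have "norm u \<le> norm t + 1"
        using norm_triangle_ineq2 [of u t] \<delta>(2) by simp
      have yx: "y - x \<in> E"
        using y x by (simp add: in_E)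
      have "p (s u y - s t x) = p (s u (y - x) + s (u - t) x)"
        by (simp add: scale_right_diff_distrib scale_left_diff_distrib)
      also have "\<dots> \<le> p (s u (y - x)) + p (s (u - t) x)"
        using x yx by (intro p_triangle scale_in_E)
      also have "\<dots> = norm u * p (y - x) + norm (u - t) * p x"
        using x yx by (simp only: p_scale)
      also have "\<dots> \<le> (norm t + 1) * p (y - x) + \<delta> * p x"
        using \<open>norm u \<le> norm t + 1\<close> u_t px p_nonneg [OF yx] by (intro add_mono mult_right_mono) auto
      also have "\<dots> < (norm t + 1) * \<eta> + r / 2"
        using y \<delta>(3) \<open>0 < norm t + 1\<close> by (intro add_less_le_mono mult_strict_left_mono) auto
      finally show ?thesis
        using r(2) \<eta>(2) y by (simp add: in_E)
    qed
    then have "ball t \<delta> \<times> {y \<in> E. p (y - x) < \<eta>} \<subseteq> ?S"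
      by auto
    moreover have "openin seminorm_topology {y \<in> E. p (y - x) < \<eta>}" "openin euclidean (ball t \<delta>)"
        "t \<in> ball t \<delta>" "x \<in> {y \<in> E. p (y - x) < \<eta>}"
      using x \<delta>(1) \<eta>(1) by (auto simp: openin_seminorm_ball)
    ultimately show "\<exists>V W. openin euclidean V \<and> openin seminorm_topology W \<and>
        t \<in> V \<and> x \<in> W \<and> V \<times> W \<subseteq> ?S"
      by blast
  qed
qed (auto simp: in_E)

lemma locally_convex_seminorm_topology: "locally_convex_space s seminorm_topology"
  unfolding locally_convex_space_def topological_vector_space_def
proof (intro conjI allI impI)
  show "vector_space s" ..
  show "module.subspace s (topspace seminorm_topology)"
    using subspace_E by simp
next
  fix U
  assume "openin seminorm_topology U \<and> 0 \<in> U"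
  then obtain r where r: "0 < r" "\<forall>y\<in>E. p (y - 0) < r \<longrightarrow> y \<in> U"
    unfolding openin_seminorm_topology by blast
  have "convex_wrt s {y \<in> E. p (y - 0) < r}"
    unfolding convex_wrt_def
  proof (intro ballI allI impI)
    fix x y and t :: real
    assume x: "x \<in> {y \<in> E. p (y - 0) < r}" and y: "y \<in> {y \<in> E. p (y - 0) < r}" and t: "0 \<le> t \<and> t \<le> 1"
    have "norm (of_real (1 - t) :: 'k) = 1 - t" "norm (of_real t :: 'k) = t"
      using t by (simp_all only: norm_of_real) auto
    then have "p (s (of_real (1 - t)) x + s (of_real t) y) \<le> (1 - t) * p x + t * p y"
      using p_triangle [of "s (of_real (1 - t)) x" "s (of_real t) y"] x y
      by (simp add: in_E p_scale del: of_real_diff)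
    also have "\<dots> < r"
      using convex_bound_lt [of "p x" r "p y" "1 - t" t] x y t by simp
    finally show "s (of_real (1 - t)) x + s (of_real t) y \<in> {y \<in> E. p (y - 0) < r}"
      using x y by (simp add: in_E)
  qed
  then show "\<exists>V. openin seminorm_topology V \<and> convex_wrt s V \<and> 0 \<in> V \<and> V \<subseteq> U"
    using r openin_seminorm_ball [OF zero_in_E, of r]
    by (intro exI [of _ "{y \<in> E. p (y - 0) < r}"]) (auto simp: zero_in_E)
qed (rule continuous_add_seminorm_topology continuous_scale_seminorm_topology)+

end

lemma (in top_vector_space) continuous_map_affine:
  assumes "a \<in> topspace X"
  shows "continuous_map X X (\<lambda>y. s t (y - a))"
proof -
  have add: "continuous_map (prod_topology X X) X (\<lambda>(x, y). x + y)"
    and scale: "continuous_map (prod_topology euclidean X) X (\<lambda>(c, x). s c x)"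
    using tvs by (auto simp: topological_vector_space_def)
  have "continuous_map X (prod_topology X X) (\<lambda>y. (y, - a))"
    using assms by (simp add: continuous_map_paired minus_in)
  from continuous_map_compose [OF this add] have "continuous_map X X (\<lambda>y. y - a)"
    by (simp add: o_def)
  then have "continuous_map X (prod_topology euclidean X) (\<lambda>y. (t, y - a))"
    by (simp add: continuous_map_paired)
  from continuous_map_compose [OF this scale] show ?thesis
    by (simp add: o_def)
qed

text \<open>
  A seminorm on the inductive limit is continuous if it is bounded by \<open>1\<close> on a neighbourhood of \<open>0\<close> of
  each step: its topology is then one of the locally convex topologies of which the inductive
  limit topology is the finest.
\<close>

lemma openin_inductive_limit_seminorm_ball:
  fixes s :: "'k::real_or_complex_field \<Rightarrow> 'a::ab_group_add \<Rightarrow> 'a"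
  assumes lim: "inductive_limit s T X"
    and steps: "\<And>m. topological_vector_space s (T m)"
    and p: "seminormed_space s (topspace X) p"
    and bounded: "\<And>m. \<exists>U. openin (T m) U \<and> 0 \<in> U \<and> (\<forall>x\<in>U. p x < 1)"
    and x: "x \<in> topspace X"
  shows "openin X {y \<in> topspace X. p (y - x) < r}"
proof -
  interpret p: seminormed_space s "topspace X" p
    by (rule p)
  have E: "topspace X = (\<Union>m. topspace (T m))"
    using lim by (simp add: inductive_limit_def compatible_topology_def)
  have "continuous_map (T m) p.seminorm_topology id" for m
    unfolding continuous_map_def
  proof (intro conjI allI impI)
    fix V
    assume V: "openin p.seminorm_topology V"
    interpret Tm: top_vector_space s "T m"
      by (intro top_vector_space.intro p.vector_space_axioms top_vector_space_axioms.intro steps)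
    show "openin (T m) {x \<in> topspace (T m). id x \<in> V}"
    proof (subst openin_subopen, intro ballI)
      fix a
      assume "a \<in> {x \<in> topspace (T m). id x \<in> V}"
      then have a: "a \<in> topspace (T m)" "a \<in> V"
        by auto
      then obtain r where r: "0 < r" "\<forall>y\<in>topspace X. p (y - a) < r \<longrightarrow> y \<in> V"
        using V unfolding p.openin_seminorm_topology by blast
      obtain U where U: "openin (T m) U" "0 \<in> U" "\<forall>x\<in>U. p x < 1"
        using bounded by blast
      define W where "W = {y \<in> topspace (T m). s (of_real (1 / r)) (y - a) \<in> U}"
      have "openin (T m) W"
        using Tm.continuous_map_affine [OF a(1)] U(1) unfolding W_def by (rule openin_continuous_map_preimage)
      moreover have "a \<in> W"
        using a U(2) by (simp add: W_def)
      moreover have "y \<in> V" if "y \<in> W" for y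
      proof -
        have y: "y \<in> topspace X" "y - a \<in> topspace X"
          using that a Tm.diff_in unfolding E W_def by blast+
        have "p (s (of_real (1 / r)) (y - a)) < 1"
          using that U(3) unfolding W_def by blast
        then have "norm (of_real (1 / r) :: 'k) * p (y - a) < 1"
          unfolding p.p_scale [OF y(2)] .
        then have "p (y - a) < r"
          using r(1) by (simp add: norm_divide field_simps)
        with r(2) y(1) show ?thesis
          by blast
      qed
      ultimately show "\<exists>W. openin (T m) W \<and> a \<in> W \<and> W \<subseteq> {x \<in> topspace (T m). id x \<in> V}"
        using openin_subset by (intro exI [of _ W]) auto
    qed
  next
    have "topspace (T m) \<subseteq> topspace X"
      unfolding E by blast
    then show "id \<in> topspace (T m) \<rightarrow> topspace p.seminorm_topology"
      by auto
  qed
  then have "compatible_topology s T p.seminorm_topology"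
    unfolding compatible_topology_def E [symmetric]
    using p.locally_convex_seminorm_topology by simp
  then show ?thesis
    using lim p.openin_seminorm_ball [OF x] by (auto simp: inductive_limit_def)
qed


section \<open>Coordinates on an LF-space with a stepwise Schauder basis\<close>

lemma frechet_space_F_space:
  assumes "frechet_space s Y"
  obtains d where "F_space s Y d"
proof -
  from assms obtain d where tvs: "topological_vector_space s Y"
    and d: "Metric_space (topspace Y) d" "Metric_space.mcomplete (topspace Y) d"
      "Metric_space.mtopology (topspace Y) d = Y"
      "\<forall>x\<in>topspace Y. \<forall>y\<in>topspace Y. \<forall>z\<in>topspace Y. d (x + z) (y + z) = d x y"
    by (auto simp: frechet_space_def locally_convex_space_def)
  have "top_vector_space s Y"
    using tvs by (simp add: top_vector_space_def top_vector_space_axioms_def topological_vector_space_def)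
  then have "F_space s Y d"
    using d by (simp add: F_space_def F_space_axioms_def)
  with that show ?thesis .
qed

text \<open>An LF-space with a stepwise Schauder basis.\<close>

locale LF_space_basis = vector_space s
  for s :: "'k::real_or_complex_field \<Rightarrow> 'a::ab_group_add \<Rightarrow> 'a" +
  fixes T :: "nat \<Rightarrow> 'a topology" and X :: "'a topology" and e :: "nat \<Rightarrow> 'a"
  assumes LF: "LF_space s T X"
    and basis: "stepwise_schauder_basis s T e"
begin

lemma frechet_step: "frechet_space s (T m)"
  using LF by (simp add: LF_space_def inductive_spectrum_def)

lemma inductive_limit_X: "inductive_limit s T X"
  using LF by (simp add: LF_space_def)

sublocale step: top_vector_space s "T m" for m
  using frechet_step [of m]
  by unfold_locales (simp add: frechet_space_def locally_convex_space_def)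

sublocale top_vector_space s X
  using inductive_limit_X by unfold_locales
    (simp add: inductive_limit_def compatible_topology_def locally_convex_space_def)

lemma topspace_X: "topspace X = (\<Union>m. topspace (T m))"
  using inductive_limit_X by (simp add: inductive_limit_def compatible_topology_def)

lemma continuous_step_limit: "continuous_map (T m) X id"
  using inductive_limit_X by (simp add: inductive_limit_def compatible_topology_def)

lemma continuous_steps: "m \<le> n \<Longrightarrow> continuous_map (T m) (T n) id"
proof (induction n rule: dec_induct)
  case (step n)
  have "continuous_map (T n) (T (Suc n)) id"
    using LF by (simp add: LF_space_def inductive_spectrum_def)
  from continuous_map_compose [OF step.IH this] show ?case
    by simp
qed simp

lemma limitin_steps:
  assumes "limitin (T m) f x F" "m \<le> n"
  shows "limitin (T n) f x F"
  using continuous_map_limit [OF continuous_steps assms(1), of n] assms(2) by (simp add: o_def)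

lemma limitin_step_limit:
  assumes "limitin (T m) f x F"
  shows "limitin X f x F"
  using continuous_map_limit [OF continuous_step_limit assms] by (simp add: o_def)

lemma step_mono: "m \<le> n \<Longrightarrow> topspace (T m) \<subseteq> topspace (T n)"
  using continuous_steps [of m n] by (auto simp: continuous_map_def Pi_iff)

lemma basis_in: "e j \<in> topspace (T m)"
proof -
  have "range e \<subseteq> topspace (T m)"
    using basis by (simp add: stepwise_schauder_basis_def schauder_basis_def)
  then show ?thesis
    by blast
qed

lemma basis_in_X: "e j \<in> topspace X"
  using basis_in by (auto simp: topspace_X)

text \<open>
  The coordinates of \<open>x\<close>, defined by expansions that converge in some step. Uniqueness of expansions
  converging in the weaker topology of \<open>X\<close> is neither available nor needed.
\<close>

definition coord :: "'a \<Rightarrow> nat \<Rightarrow> 'k" where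
  "coord x = (THE a. \<exists>m. limitin (T m) (\<lambda>n. \<Sum>j<n. s (a j) (e j)) x sequentially)"

lemma coord_unique:
  assumes "limitin (T m) (\<lambda>n. \<Sum>j<n. s (a j) (e j)) x sequentially"
  shows "coord x = a"
  unfolding coord_def
proof (rule the_equality)
  show "\<exists>m. limitin (T m) (\<lambda>n. \<Sum>j<n. s (a j) (e j)) x sequentially"
    using assms by blast
next
  fix b
  assume "\<exists>m. limitin (T m) (\<lambda>n. \<Sum>j<n. s (b j) (e j)) x sequentially"
  then obtain m' where m': "limitin (T m') (\<lambda>n. \<Sum>j<n. s (b j) (e j)) x sequentially"
    by blast
  define n where "n = max m m'"
  have a: "limitin (T n) (\<lambda>n. \<Sum>j<n. s (a j) (e j)) x sequentially"
    and b: "limitin (T n) (\<lambda>n. \<Sum>j<n. s (b j) (e j)) x sequentially"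
    using limitin_steps [OF assms, of n] limitin_steps [OF m', of n] by (simp_all add: n_def)
  then have "x \<in> topspace (T n)"
    by (simp add: limitin_def)
  then have "\<exists>!a. limitin (T n) (\<lambda>n. \<Sum>j<n. s (a j) (e j)) x sequentially"
    using basis by (simp add: stepwise_schauder_basis_def schauder_basis_def)
  with a b show "b = a"
    by blast
qed

lemma expansion:
  assumes "x \<in> topspace (T m)"
  shows "limitin (T m) (\<lambda>n. \<Sum>j<n. s (coord x j) (e j)) x sequentially"
proof -
  have "\<exists>!a. limitin (T m) (\<lambda>n. \<Sum>j<n. s (a j) (e j)) x sequentially"
    using basis assms by (simp add: stepwise_schauder_basis_def schauder_basis_def)
  then show ?thesis
    using coord_unique by metis
qed

lemma step_F_space_basis:
  obtains d where "F_space_basis s (T m) d e coord"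
proof -
  obtain d where "F_space s (T m) d"
    using frechet_space_F_space frechet_step .
  then interpret F_space s "T m" d .
  have "F_space_basis s (T m) d e coord"
    by unfold_locales (auto intro: basis_in expansion coord_unique)
  with that show ?thesis .
qed

lemma expansion_X:
  assumes "x \<in> topspace X"
  shows "limitin X (\<lambda>n. \<Sum>j<n. s (coord x j) (e j)) x sequentially"
  using assms expansion limitin_step_limit unfolding topspace_X by blast

lemma coord_add:
  assumes "x \<in> topspace X" "y \<in> topspace X"
  shows "coord (x + y) = (\<lambda>j. coord x j + coord y j)"
proof -
  obtain m n where "x \<in> topspace (T m)" "y \<in> topspace (T n)"
    using assms by (auto simp: topspace_X)
  then have xy: "x \<in> topspace (T (max m n))" "y \<in> topspace (T (max m n))"
    using step_mono [of m "max m n"] step_mono [of n "max m n"] by auto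
  obtain d where "F_space_basis s (T (max m n)) d e coord"
    by (rule step_F_space_basis)
  then show ?thesis
    using xy by (rule F_space_basis.coord_add)
qed

lemma coord_scale:
  assumes "x \<in> topspace X"
  shows "coord (s t x) = (\<lambda>j. t * coord x j)"
proof -
  obtain m where x: "x \<in> topspace (T m)"
    using assms by (auto simp: topspace_X)
  obtain d where "F_space_basis s (T m) d e coord"
    by (rule step_F_space_basis)
  then show ?thesis
    using x by (rule F_space_basis.coord_scale)
qed

lemma coord_diff:
  assumes "x \<in> topspace X" "y \<in> topspace X"
  shows "coord (x - y) = (\<lambda>j. coord x j - coord y j)"
  using coord_add [OF assms(1) scale_in [OF assms(2)], of "- 1"] coord_scale [OF assms(2), of "- 1"]
  by simp

lemma coord_finite_sum: "coord (\<Sum>i<n. s (a i) (e i)) = (\<lambda>j. if j < n then a j else 0)"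
proof -
  obtain d where "F_space_basis s (T 0) d e coord"
    by (rule step_F_space_basis)
  then show ?thesis
    by (rule F_space_basis.coord_finite_sum)
qed

lemma coord_zero: "coord 0 = (\<lambda>j. 0)"
  using coord_finite_sum [of "\<lambda>_. 0" 0] by simp

text \<open>No subsequence of \<open>e\<close> with indices in \<open>J\<close> tends to \<open>0\<close> in any of the steps.\<close>

definition no_null_subsequence :: "nat set \<Rightarrow> bool" where
  "no_null_subsequence J \<longleftrightarrow>
     (\<forall>m. \<forall>j::nat \<Rightarrow> nat. strict_mono j \<and> range j \<subseteq> J \<longrightarrow>
        \<not> limitin (T m) (\<lambda>k. e (j k)) 0 sequentially)"

lemma no_null_subsequence_finite:
  assumes "finite J"
  shows "no_null_subsequence J"
proof -
  have "\<not> range j \<subseteq> J" if "strict_mono j" for j :: "nat \<Rightarrow> nat"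
    using that assms finite_subset range_inj_infinite strict_mono_imp_inj_on by blast
  then show ?thesis
    by (auto simp: no_null_subsequence_def)
qed

lemma coords_small_near_0:
  assumes "no_null_subsequence J"
  shows "\<exists>U. openin (T m) U \<and> 0 \<in> U \<and> (\<forall>x\<in>U. \<forall>i\<in>J. norm (coord x i) < 1/2)"
proof -
  obtain d where "F_space_basis s (T m) d e coord"
    by (rule step_F_space_basis)
  then interpret F: F_space_basis s "T m" d e coord .
  obtain \<delta> where \<delta>: "0 < \<delta>"
    "\<And>x i. x \<in> topspace (T m) \<Longrightarrow> F.N x < \<delta> \<Longrightarrow> i \<in> J \<Longrightarrow> norm (coord x i) < 1"
    using F.coords_small_near_0 assms unfolding no_null_subsequence_def by metis
  \<comment> \<open>The bound \<open>1/2\<close> instead of \<open>1\<close> keeps the supremum over \<open>J\<close> strictly below \<open>1\<close>.\<close>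
  define U where "U = {y \<in> topspace (T m). s 2 (y - 0) \<in> F.mball 0 \<delta>}"
  have "openin (T m) (F.mball 0 \<delta>)"
    using F.openin_mball [of 0 \<delta>] unfolding F.mtopology .
  then have "openin (T m) U"
    unfolding U_def by (rule openin_continuous_map_preimage [OF step.continuous_map_affine [OF step.zero_in]])
  moreover have "0 \<in> U"
    using \<delta>(1) step.zero_in by (simp add: U_def)
  moreover have "norm (coord x i) < 1/2" if "x \<in> U" "i \<in> J" for x i
  proof -
    have x: "x \<in> topspace (T m)" "F.N (s 2 x) < \<delta>"
      using that(1) by (auto simp: U_def F.N_def F.commute)
    then have "norm (coord (s 2 x) i) < 1"
      using that(2) by (intro \<delta>(2) step.scale_in)
    then show ?thesis
      using x by (simp add: F.coord_scale norm_mult)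
  qed
  ultimately show ?thesis
    by blast
qed

text \<open>
  The seminorm \<open>q\<^sub>J\<close>. The supremum is meaningful for nonempty \<open>J\<close> with \<open>no_null_subsequence J\<close> and for
  \<open>x\<close> in the LF-space, where it is taken over a bounded set.
\<close>

definition coord_sup :: "nat set \<Rightarrow> 'a \<Rightarrow> real" where
  "coord_sup J x = (SUP i\<in>J. norm (coord x i))"

context
  fixes J :: "nat set"
  assumes J: "no_null_subsequence J" "J \<noteq> {}"
begin

lemma bdd_above_coords:
  assumes "x \<in> topspace X"
  shows "bdd_above ((\<lambda>i. norm (coord x i)) ` J)"
proof -
  obtain m where x: "x \<in> topspace (T m)"
    using assms by (auto simp: topspace_X)
  obtain U where U: "openin (T m) U" "0 \<in> U" "\<forall>x\<in>U. \<forall>i\<in>J. norm (coord x i) < 1/2"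
    using coords_small_near_0 [OF J(1)] by blast
  have "(\<lambda>k. of_real (inverse (real (Suc k))) :: 'k) \<longlonglongrightarrow> of_real 0"
    by (intro tendsto_of_real LIMSEQ_inverse_real_of_nat)
  then have "limitin (T m) (\<lambda>k. s (of_real (inverse (real (Suc k)))) x) (s (of_real 0) x) sequentially"
    using x by (intro step.limitin_scale) auto
  then have "\<forall>\<^sub>F k in sequentially. s (of_real (inverse (real (Suc k)))) x \<in> U"
    using U by (simp add: limitin_def)
  then obtain k where k: "s (of_real (inverse (real (Suc k)))) x \<in> U"
    unfolding eventually_sequentially by blast
  have "norm (coord x i) \<le> real (Suc k)" if "i \<in> J" for i
  proof -
    have "norm (coord (s (of_real (inverse (real (Suc k)))) x) i) < 1/2"
      using U(3) k that by blast
    then have "inverse (real (Suc k)) * norm (coord x i) < 1/2"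
      unfolding coord_scale [OF assms] norm_mult norm_of_real by simp
    then show ?thesis
      by (simp add: field_simps)
  qed
  then show ?thesis
    by (rule bdd_aboveI2)
qed

lemma norm_coord_le_coord_sup:
  assumes "x \<in> topspace X" "i \<in> J"
  shows "norm (coord x i) \<le> coord_sup J x"
  unfolding coord_sup_def by (rule cSUP_upper [OF assms(2) bdd_above_coords [OF assms(1)]])

lemma coord_sup_le:
  assumes "\<And>i. i \<in> J \<Longrightarrow> norm (coord x i) \<le> r"
  shows "coord_sup J x \<le> r"
  unfolding coord_sup_def by (rule cSUP_least [OF J(2) assms])

lemma seminormed_coord_sup: "seminormed_space s (topspace X) (coord_sup J)"
proof
  show "subspace (topspace X)"
    by (rule subspace_topspace)
next
  fix x y
  assume xy: "x \<in> topspace X" "y \<in> topspace X"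
  show "coord_sup J (x + y) \<le> coord_sup J x + coord_sup J y"
  proof (rule coord_sup_le)
    fix i
    assume "i \<in> J"
    with xy show "norm (coord (x + y) i) \<le> coord_sup J x + coord_sup J y"
      by (simp add: coord_add norm_triangle_mono norm_coord_le_coord_sup)
  qed
next
  have le: "coord_sup J (s t x) \<le> norm t * coord_sup J x" if "x \<in> topspace X" for t x
    using that by (intro coord_sup_le) (simp add: coord_scale norm_mult mult_left_mono norm_coord_le_coord_sup)
  fix x and t :: 'k
  assume x: "x \<in> topspace X"
  show "coord_sup J (s t x) = norm t * coord_sup J x"
  proof (cases "t = 0")
    case True
    obtain i where "i \<in> J"
      using J(2) by blast
    then have "norm (coord (s t x) i) \<le> coord_sup J (s t x)"
      using x by (intro norm_coord_le_coord_sup scale_in)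
    then have "0 \<le> coord_sup J (s t x)"
      using norm_ge_zero order_trans by blast
    with le [OF x, of t] True show ?thesis
      by simp
  next
    case False
    have "coord_sup J x \<le> norm (inverse t) * coord_sup J (s t x)"
      using le [OF scale_in [OF x], of "inverse t" t] False by simp
    then have "norm t * coord_sup J x \<le> coord_sup J (s t x)"
      using False by (simp add: norm_divide field_simps)
    with le [OF x, of t] show ?thesis
      by simp
  qed
qed

lemma openin_coord_sup_ball:
  assumes "x \<in> topspace X"
  shows "openin X {y \<in> topspace X. coord_sup J (y - x) < r}"
proof (rule openin_inductive_limit_seminorm_ball [OF inductive_limit_X step.tvs seminormed_coord_sup _ assms])
  fix m
  obtain U where U: "openin (T m) U" "0 \<in> U" "\<forall>x\<in>U. \<forall>i\<in>J. norm (coord x i) < 1/2"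
    using coords_small_near_0 [OF J(1)] by blast
  have "coord_sup J x \<le> 1/2" if "x \<in> U" for x
    using U(3) that by (intro coord_sup_le) (simp add: less_imp_le)
  then show "\<exists>U. openin (T m) U \<and> 0 \<in> U \<and> (\<forall>x\<in>U. coord_sup J x < 1)"
    using U by (intro exI [of _ U]) fastforce
qed

end

lemma tendsto_coord:
  assumes "limitin X f x F"
  shows "((\<lambda>n. coord (f n) j) \<longlongrightarrow> coord x j) F"
proof (rule tendstoI)
  fix \<epsilon> :: real
  assume "0 < \<epsilon>"
  have x: "x \<in> topspace X"
    using assms by (simp add: limitin_def)
  have "x \<in> {y \<in> topspace X. coord_sup {j} (y - x) < \<epsilon>}"
    using x \<open>0 < \<epsilon>\<close> by (simp add: coord_sup_def coord_zero)
  moreover have "openin X {y \<in> topspace X. coord_sup {j} (y - x) < \<epsilon>}"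
    by (intro openin_coord_sup_ball no_null_subsequence_finite x) auto
  ultimately have "\<forall>\<^sub>F n in F. f n \<in> {y \<in> topspace X. coord_sup {j} (y - x) < \<epsilon>}"
    using assms unfolding limitin_def by blast
  then show "\<forall>\<^sub>F n in F. dist (coord (f n) j) (coord x j) < \<epsilon>"
    by eventually_elim (use x in \<open>auto simp: coord_sup_def coord_diff dist_norm\<close>)
qed

end

section \<open>Return sets of the backward shift\<close>

text \<open>An LF-space with a stepwise Schauder basis and associated backward shift \<open>B\<close>.\<close>

locale LF_backward_shift = LF_space_basis s T X e
  for s :: "'k::real_or_complex_field \<Rightarrow> 'a::ab_group_add \<Rightarrow> 'a"
    and T X and e :: "nat \<Rightarrow> 'a" +
  fixes B :: "'a \<Rightarrow> 'a"
  assumes shift: "associated_backward_shift s X e B"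
begin

lemma shift_continuous: "continuous_map X X B"
  and shift_add: "x \<in> topspace X \<Longrightarrow> y \<in> topspace X \<Longrightarrow> B (x + y) = B x + B y"
  and shift_scale: "x \<in> topspace X \<Longrightarrow> B (s t x) = s t (B x)"
  and shift_basis_0: "B (e 0) = 0"
  and shift_basis_Suc: "B (e (Suc j)) = e j"
  using shift by (auto simp: associated_backward_shift_def continuous_linear_operator_def)

lemma funpow_continuous: "continuous_map X X (B ^^ n)"
proof (induction n)
  case (Suc n)
  from continuous_map_compose [OF Suc shift_continuous] show ?case
    by (simp add: o_def)
qed (simp add: id_def [symmetric])

lemma funpow_in: "x \<in> topspace X \<Longrightarrow> (B ^^ n) x \<in> topspace X"
  using funpow_continuous [of n] by (auto simp: continuous_map_def Pi_iff)

lemma funpow_add_vec: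
  "x \<in> topspace X \<Longrightarrow> y \<in> topspace X \<Longrightarrow> (B ^^ n) (x + y) = (B ^^ n) x + (B ^^ n) y"
  by (induction n) (simp_all add: shift_add funpow_in)

lemma funpow_scale: "x \<in> topspace X \<Longrightarrow> (B ^^ n) (s t x) = s t ((B ^^ n) x)"
  by (induction n) (simp_all add: shift_scale funpow_in)

lemma funpow_zero: "(B ^^ n) 0 = 0"
  using funpow_scale [OF zero_in, of n 0] by simp

lemma funpow_sum:
  assumes "\<And>i. i \<in> I \<Longrightarrow> f i \<in> topspace X"
  shows "(B ^^ n) (\<Sum>i\<in>I. s (a i) (f i)) = (\<Sum>i\<in>I. s (a i) ((B ^^ n) (f i)))"
  using assms
  by (induction I rule: infinite_finite_induct)
    (simp_all add: funpow_zero funpow_add_vec funpow_scale scale_in sum_in)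

lemma funpow_basis: "(B ^^ n) (e i) = (if n \<le> i then e (i - n) else 0)"
proof (induction n)
  case (Suc n)
  have "B 0 = 0"
    using funpow_zero [of 1] by simp
  then show ?case
    using Suc shift_basis_0 shift_basis_Suc [of "i - Suc n"]
    by (auto simp: Suc_diff_Suc not_le le_less_Suc_eq dest: le_neq_implies_less)
qed simp

text \<open>
  This is clear for finite linear combinations of the basis, and the coordinate functionals and \<open>B\<close>
  are continuous.
\<close>

lemma coord_shift:
  assumes x: "x \<in> topspace X"
  shows "coord (B x) j = coord x (Suc j)"
proof -
  have "limitin X (\<lambda>n. B (\<Sum>i<n. s (coord x i) (e i))) (B x) sequentially"
    using continuous_map_limit [OF shift_continuous expansion_X [OF x]] by (simp add: o_def)
  then have "(\<lambda>n. coord (B (\<Sum>i<n. s (coord x i) (e i))) j) \<longlonglongrightarrow> coord (B x) j"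
    by (rule tendsto_coord)
  then have "(\<lambda>n. coord (B (\<Sum>i<Suc n. s (coord x i) (e i))) j) \<longlonglongrightarrow> coord (B x) j"
    by (rule LIMSEQ_Suc)
  moreover have "\<forall>\<^sub>F n in sequentially. coord (B (\<Sum>i<Suc n. s (coord x i) (e i))) j = coord x (Suc j)"
    using eventually_gt_at_top [of j]
  proof eventually_elim
    case (elim n)
    have "B (\<Sum>i<Suc n. s (coord x i) (e i)) = (\<Sum>i<Suc n. s (coord x i) (B (e i)))"
      using funpow_sum [of "{..<Suc n}" e 1 "coord x"] by (simp add: basis_in_X del: sum.lessThan_Suc)
    also have "\<dots> = (\<Sum>i<n. s (coord x (Suc i)) (e i))"
      unfolding sum.lessThan_Suc_shift by (simp add: shift_basis_0 shift_basis_Suc)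
    finally show ?case
      using elim by (simp add: coord_finite_sum [of "\<lambda>i. coord x (Suc i)"])
  qed
  ultimately show ?thesis
    by (intro LIMSEQ_unique [OF _ tendsto_eventually])
qed

lemma coord_funpow: "x \<in> topspace X \<Longrightarrow> coord ((B ^^ n) x) j = coord x (j + n)"
  by (induction n arbitrary: j) (simp_all add: coord_shift funpow_in)

text \<open>
  The times in \<open>J\<close> are not return times for the unit ball of \<open>q\<^sub>J\<close> and the set of points whose
  coordinate at \<open>0\<close> has distance less than \<open>1\<close> from \<open>2\<close>.
\<close>

lemma return_set_avoids:
  assumes J: "no_null_subsequence J" "J \<noteq> {}"
  obtains U V where "openin X U" "U \<noteq> {}" "openin X V" "V \<noteq> {}" "return_set B U V \<inter> J = {}"
proof -
  define U where "U = {y \<in> topspace X. coord_sup J (y - 0) < 1}"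
  define V where "V = {y \<in> topspace X. coord_sup {0} (y - s 2 (e 0)) < 1}"
  have e0: "s 2 (e 0) \<in> topspace X"
    by (intro scale_in basis_in_X)
  have "openin X U"
    unfolding U_def by (intro openin_coord_sup_ball J zero_in)
  moreover have "openin X V"
    unfolding V_def by (intro openin_coord_sup_ball no_null_subsequence_finite e0) auto
  moreover have "0 \<in> U"
    using coord_sup_le [OF J, of 0 0] by (simp add: U_def zero_in coord_zero)
  moreover have "s 2 (e 0) \<in> V"
    using e0 by (simp add: V_def coord_sup_def coord_zero)
  moreover have "return_set B U V \<inter> J = {}"
  proof -
    have False if "n \<in> J" "x \<in> U" "(B ^^ n) x \<in> V" for n x
    proof -
      have x: "x \<in> topspace X" "coord_sup J x < 1"
        using that(2) by (auto simp: U_def)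
      then have small: "norm (coord x n) < 1"
        using norm_coord_le_coord_sup [OF J x(1) that(1)] by simp
      have "coord (s 2 (e 0)) 0 = 2"
        using coord_finite_sum [of "\<lambda>_. 2" 1] by simp
      then have "coord ((B ^^ n) x - s 2 (e 0)) 0 = coord x n - 2"
        using x e0 by (simp add: coord_diff funpow_in coord_funpow)
      then have "norm (coord x n - 2) < 1"
        using that(3) by (simp add: V_def coord_sup_def)
      moreover have "norm (2 :: 'k) \<le> norm (coord x n) + norm (coord x n - 2)"
        using norm_triangle_ineq4 [of "coord x n" "coord x n - 2"] by simp
      ultimately show False
        using small by simp
    qed
    then show ?thesis
      by (auto simp: return_set_def)
  qed
  ultimately show ?thesis
    using that by blast
qed

text \<open>The offset \<open>M\<close> depends on \<open>U\<close> and \<open>V\<close>, but not on the null subsequence.\<close>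

lemma eventually_in_return_set:
  assumes U: "openin X U" "U \<noteq> {}" and V: "openin X V" "V \<noteq> {}"
  obtains M where "\<And>m j. strict_mono j \<Longrightarrow> limitin (T m) (\<lambda>k. e (j k)) 0 sequentially \<Longrightarrow>
    \<forall>\<^sub>F k in sequentially. M \<le> j k \<and> j k - M \<in> return_set B U V"
proof -
  obtain u v where u: "u \<in> U" and v: "v \<in> V"
    using U V by blast
  then have uv: "u \<in> topspace X" "v \<in> topspace X"
    using openin_subset U V by blast+
  define P where "P x n = (\<Sum>i<n. s (coord x i) (e i))" for x n
  have P_in: "P x n \<in> topspace X" for x n
    unfolding P_def by (intro sum_in scale_in basis_in_X)
  have "\<forall>\<^sub>F n in sequentially. P u n \<in> U" "\<forall>\<^sub>F n in sequentially. P v n \<in> V"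
    using expansion_X [OF uv(1)] expansion_X [OF uv(2)] u v U V by (simp_all add: limitin_def P_def)
  then have "\<forall>\<^sub>F n in sequentially. P u n \<in> U \<and> P v n \<in> V"
    by (rule eventually_conj)
  then obtain M where M: "P u M \<in> U" "P v M \<in> V"
    unfolding eventually_sequentially by blast
  have "\<forall>\<^sub>F k in sequentially. M \<le> j k \<and> j k - M \<in> return_set B U V"
    if j: "strict_mono j" and null: "limitin (T m) (\<lambda>k. e (j k)) 0 sequentially" for m j
  proof -
    \<comment> \<open>For \<open>i < M \<le> j k\<close>, the vector \<open>(B ^^ (M - i)) (e (j k))\<close> is \<open>e (i + (j k - M))\<close>, the forward shift of \<open>e i\<close>.\<close>
    define w where "w k = P u M + (\<Sum>i<M. s (coord v i) ((B ^^ (M - i)) (e (j k))))" for k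
    have "limitin X ((B ^^ (M - i)) \<circ> (\<lambda>k. e (j k))) ((B ^^ (M - i)) 0) sequentially" for i
      by (rule continuous_map_limit [OF funpow_continuous limitin_step_limit [OF null]])
    then have "limitin X (\<lambda>k. (B ^^ (M - i)) (e (j k))) 0 sequentially" for i
      by (simp add: o_def funpow_zero)
    then have "limitin X w (P u M + (\<Sum>i<M. s (coord v i) 0)) sequentially"
      unfolding w_def by (intro limitin_add limitin_sum limitin_scale tendsto_const) (simp_all add: P_in)
    then have "\<forall>\<^sub>F k in sequentially. w k \<in> U"
      using U(1) M(1) by (simp add: limitin_def)
    then show ?thesis
      \<comment> \<open>This makes \<open>j k - M \<ge> M\<close>, so that the shift annihilates \<open>P u M\<close>, and \<open>j k - M \<ge> 1\<close>.\<close>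
      using eventually_ge_at_top [of "2 * M + 1"]
    proof eventually_elim
      case (elim k)
      define n where "n = j k - M"
      have n: "j k = n + M" "M \<le> n" "1 \<le> n"
        using elim(2) seq_suble [OF j, of k] by (auto simp: n_def)
      have "(B ^^ n) (P u M) = (\<Sum>i<M. s (coord u i) ((B ^^ n) (e i)))"
        unfolding P_def by (intro funpow_sum basis_in_X)
      also have "\<dots> = 0"
        using n(2) by (intro sum.neutral) (simp add: funpow_basis)
      finally have *: "(B ^^ n) (P u M) = 0" .
      have "(B ^^ n) (\<Sum>i<M. s (coord v i) ((B ^^ (M - i)) (e (j k)))) =
          (\<Sum>i<M. s (coord v i) ((B ^^ n) ((B ^^ (M - i)) (e (j k)))))"
        by (intro funpow_sum funpow_in basis_in_X)
      also have "\<dots> = P v M"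
        unfolding P_def
      proof (intro sum.cong refl)
        fix i
        assume "i \<in> {..<M}"
        then have "(B ^^ (n + (M - i))) (e (j k)) = e i"
          using n(1) by (simp add: funpow_basis)
        then have "(B ^^ n) ((B ^^ (M - i)) (e (j k))) = e i"
          by (simp add: funpow_add del: add_diff_assoc)
        then show "s (coord v i) ((B ^^ n) ((B ^^ (M - i)) (e (j k)))) = s (coord v i) (e i)"
          by simp
      qed
      finally have "(B ^^ n) (w k) = P v M"
        unfolding w_def using *
        by (subst funpow_add_vec) (auto intro!: P_in sum_in scale_in funpow_in basis_in_X)
      then have "n \<in> return_set B U V"
        using elim(1) M(2) n(3) by (force simp: return_set_def)
      then show ?case
        using n(1) by simp
    qed
  qed
  with that show ?thesis
    by blast
qed

lemma transitive_iff:
  "topologically_transitive X B \<longleftrightarrow>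
     (\<exists>m. \<exists>j::nat \<Rightarrow> nat. strict_mono j \<and> limitin (T m) (\<lambda>k. e (j k)) 0 sequentially)"
proof
  assume B: "topologically_transitive X B"
  show "\<exists>m. \<exists>j::nat \<Rightarrow> nat. strict_mono j \<and> limitin (T m) (\<lambda>k. e (j k)) 0 sequentially"
  proof (rule ccontr)
    assume "\<not> ?thesis"
    then have "no_null_subsequence UNIV"
      by (auto simp: no_null_subsequence_def)
    from return_set_avoids [OF this UNIV_not_empty] B show False
      unfolding topologically_transitive_def by (metis inf_top_right)
  qed
next
  assume "\<exists>m. \<exists>j::nat \<Rightarrow> nat. strict_mono j \<and> limitin (T m) (\<lambda>k. e (j k)) 0 sequentially"
  then obtain m and j :: "nat \<Rightarrow> nat"
    where j: "strict_mono j" "limitin (T m) (\<lambda>k. e (j k)) 0 sequentially"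
    by blast
  show "topologically_transitive X B"
    unfolding topologically_transitive_def
  proof (intro allI impI)
    fix U V
    assume "openin X U \<and> U \<noteq> {} \<and> openin X V \<and> V \<noteq> {}"
    then obtain M where "\<forall>\<^sub>F k in sequentially. M \<le> j k \<and> j k - M \<in> return_set B U V"
      using eventually_in_return_set [of U V] j by metis
    then show "return_set B U V \<noteq> {}"
      unfolding eventually_sequentially by blast
  qed
qed

lemma mixing_iff:
  "topologically_mixing X B \<longleftrightarrow>
     (\<forall>I::nat set. infinite I \<longrightarrow>
        (\<exists>m. \<exists>j::nat \<Rightarrow> nat. strict_mono j \<and> range j \<subseteq> I \<and>
           limitin (T m) (\<lambda>k. e (j k)) 0 sequentially))"
proof (intro iffI allI impI)
  fix I :: "nat set"
  assume B: "topologically_mixing X B" and I: "infinite I"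
  show "\<exists>m. \<exists>j::nat \<Rightarrow> nat. strict_mono j \<and> range j \<subseteq> I \<and>
      limitin (T m) (\<lambda>k. e (j k)) 0 sequentially"
  proof (rule ccontr)
    assume "\<not> ?thesis"
    then have "no_null_subsequence I" "I \<noteq> {}"
      using I by (auto simp: no_null_subsequence_def)
    then obtain U V where UV: "openin X U" "U \<noteq> {}" "openin X V" "V \<noteq> {}" "return_set B U V \<inter> I = {}"
      by (rule return_set_avoids)
    \<comment> \<open>Return sets consist of positive integers, whereas \<open>0\<close> may be an index in \<open>I\<close>.\<close>
    then have "I - {0} \<subseteq> {1..} - return_set B U V"
      by auto
    moreover have "finite ({1..} - return_set B U V)"
      using B UV unfolding topologically_mixing_def by blast
    ultimately show False
      using I finite_subset by fastforce
  qed
next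
  assume *: "\<forall>I::nat set. infinite I \<longrightarrow>
        (\<exists>m. \<exists>j::nat \<Rightarrow> nat. strict_mono j \<and> range j \<subseteq> I \<and>
           limitin (T m) (\<lambda>k. e (j k)) 0 sequentially)"
  show "topologically_mixing X B"
    unfolding topologically_mixing_def
  proof (intro allI impI)
    fix U V
    assume "openin X U \<and> U \<noteq> {} \<and> openin X V \<and> V \<noteq> {}"
    then obtain M where M: "\<And>m j. strict_mono j \<Longrightarrow> limitin (T m) (\<lambda>k. e (j k)) 0 sequentially \<Longrightarrow>
        \<forall>\<^sub>F k in sequentially. M \<le> j k \<and> j k - M \<in> return_set B U V"
      using eventually_in_return_set [of U V] by metis
    show "finite ({1..} - return_set B U V)"
    proof (rule ccontr)
      assume "infinite ({1..} - return_set B U V)"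
      then have "infinite ((\<lambda>n. n + M) ` ({1..} - return_set B U V))"
        by (simp add: finite_image_iff)
      with * obtain m and j :: "nat \<Rightarrow> nat" where j: "strict_mono j"
          "range j \<subseteq> (\<lambda>n. n + M) ` ({1..} - return_set B U V)"
          "limitin (T m) (\<lambda>k. e (j k)) 0 sequentially"
        by meson
      obtain k where "j k - M \<in> return_set B U V"
        using M [OF j(1,3)] unfolding eventually_sequentially by blast
      moreover have "j k \<in> (\<lambda>n. n + M) ` ({1..} - return_set B U V)"
        using j(2) by blast
      ultimately show False
        by auto
    qed
  qed
qed

end

theorem corollary2p5:
  fixes s :: "'k::real_or_complex_field \<Rightarrow> 'a::ab_group_add \<Rightarrow> 'a"
    and T :: "nat \<Rightarrow> 'a topology"
    and X :: "'a topology"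
    and e :: "nat \<Rightarrow> 'a"
    and B :: "'a \<Rightarrow> 'a"
  assumes "LF_space s T X"
    and "stepwise_schauder_basis s T e"
    and "associated_backward_shift s X e B"
  shows "(topologically_transitive X B \<longleftrightarrow>
            (\<exists>m. \<exists>j::nat \<Rightarrow> nat. strict_mono j \<and>
               limitin (T m) (\<lambda>k. e (j k)) 0 sequentially)) \<and>
         (topologically_mixing X B \<longleftrightarrow>
            (\<forall>I::nat set. infinite I \<longrightarrow>
               (\<exists>m. \<exists>j::nat \<Rightarrow> nat. strict_mono j \<and> range j \<subseteq> I \<and>
                  limitin (T m) (\<lambda>k. e (j k)) 0 sequentially)))"
proof -
  have "vector_space s"
    using assms(1) by (simp add: LF_space_def inductive_limit_def compatible_topology_def
      locally_convex_space_def topological_vector_space_def)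
  then interpret LF_backward_shift s T X e B
    using assms by (intro LF_backward_shift.intro LF_space_basis.intro
      LF_space_basis_axioms.intro LF_backward_shift_axioms.intro)
  show ?thesis
    using transitive_iff mixing_iff by blast
qed

end
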